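(* For every $f\in\mathcal{S}_{*q,\alpha}(\mathbb{R}_q)$ the following inversion formulas for the operator $R_{\alpha,q}$ hold: $$f=R_{\alpha,q}\circ K_{\alpha,q,1}\circ W_{\alpha,q}(f),$$ $$f=R_{\alpha,q}\circ W_{\alpha,q}\circ K_{\alpha,q,2}(f).$$
   Context: Fix $q\in\,]0,1[$ with $\frac{\log(1-q)}{\log q}\in\mathbb{Z}$ and $\alpha>-\frac12$. $(a;q)_0=1$, $(a;q)_n=\prod_{k=0}^{n-1}(1-aq^k)$, $(a;q)_\infty=\prod_{k\ge0}(1-aq^k)$; $\Gamma_q(x)=\frac{(q;q)_\infty}{(q^x;q)_\infty}(1-q)^{1-x}$, and $\Gamma_{q^2}$ is the same with $q$ replaced by $q^2$. $\mathbb{R}_{q,+}=\{q^n:n\in\mathbb{Z}\}$, $\widetilde{\mathbb{R}}_{q,+}=\mathbb{R}_{q,+}\cup\{0\}$, $\mathbb{R}_q=\{\pm q^n:n\in\mathbb{Z}\}\cup\{0\}$. Jackson integrals: $\int_0^af(x)d_qx=(1-q)a\sum_{n\ge0}f(aq^n)q^n$, $\int_0^\infty f(x)d_qx=(1-q)\sum_{n\in\mathbb{Z}}f(q^n)q^n$, $\int_a^\infty=\int_0^\infty-\int_0^a$. $q$-derivative: $D_qf(x)=\frac{f(x)-f(qx)}{(1-q)x}$ for $x\ne0$, $D_qf(0)=f'(0)$. $\mathcal{S}_{*q}(\mathbb{R}_q)$: the restrictions to $\mathbb{R}_q$ of even, infinitely $q$-differentiable functions $f$ on $\mathbb{R}$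 with $P_{n,m,q}(f)=\sup_{x\in\mathbb{R},\,0\le k\le n}|(1+x^2)^mD_q^kf(x)|<\infty$ for all $n,m\in\mathbb{N}$, with the induced topology of these semi-norms. For $\beta\in\{\alpha,-\frac12\}$, $\mathcal{S}_{*q,\beta}(\mathbb{R}_q)=\{f\in\mathcal{S}_{*q}(\mathbb{R}_q):\int_0^\infty f(x)x^{2k+2\beta+1}d_qx=0,\ k=0,1,\dots\}$. For $\beta\in\{\alpha,-\frac12\}$: $j_\beta^{(3)}(z;q^2)=\sum_{n\ge0}\frac{(-1)^nq^{n(n-1)}(1-q)^{2n}z^{2n}}{(q^2;q^2)_n(q^{2\beta+2};q^2)_n}$, $c_{\beta,q}=\frac{(1+q^{-1})^{-\beta}}{\Gamma_{q^2}(\beta+1)}$. $q$-Bessel Fourier transform: $\mathcal{F}_{\alpha,q}(f)(\lambda)=c_{\alpha,q}\int_0^\infty f(x)j_\alpha^{(3)}(\lambda x;q^2)x^{2\alpha+1}d_qx$, with $\mathcal{F}_{\alpha,q}^{-1}=q^{-4\alpha-2}\mathcal{F}_{\alpha,q}$ on $\mathcal{S}_{*q}(\mathbb{R}_q)$. $q$-Fourier-cosine transform: $\mathcal{F}_q(f)(\lambda)=c_{-1/2,q}\int_0^\infty f(x)\cos(\lambda x;q^2)d_qx$ with $\cos(x;q^2)=j_{-1/2}^{(3)}(x;q^2)$; $\mathcal{F}_q^{-1}=\mathcal{F}_q$. $q$-Riemann-Liouville transform: $R_{\alpha,q}(f)(x)=\frac{(1+q)\Gamma_{q^2}(\alpha+1)}{\Gamma_{q^2}(1/2)\Gamma_{q^2}(\alpha+1/2)}\int_0^1\frac{(t^2q^2;q^2)_\infty}{(t^2q^{2\alpha+1};q^2)_\infty}f(xt)\,d_qt$.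 $q$-Weyl transform: $W_{\alpha,q}(f)(x)=\frac{q(1+q^{-1})^{-\alpha+1/2}}{\Gamma_{q^2}(\alpha+1/2)}\int_{qx}^\infty\frac{(q^2x^2/t^2;q^2)_\infty}{(q^{2\alpha+1}x^2/t^2;q^2)_\infty}f(t)t^{2\alpha}d_qt$ for $x\in\widetilde{\mathbb{R}}_{q,+}$, extended evenly to $\mathbb{R}_q$; on $\mathcal{S}_{*q}(\mathbb{R}_q)$ one has $\mathcal{F}_{\alpha,q}=\mathcal{F}_q\circ W_{\alpha,q}$. With $\kappa_\alpha=\frac{\Gamma_{q^2}(1/2)}{q^{3\alpha+3/2}(1+q)^{\alpha+1/2}\Gamma_{q^2}(\alpha+1)}$: $K_{\alpha,q,1}(f)=\kappa_\alpha\,\mathcal{F}_q^{-1}(|\lambda|^{2\alpha+1}\mathcal{F}_q(f))$ on $\mathcal{S}_{*q,-1/2}(\mathbb{R}_q)$, and $K_{\alpha,q,2}(f)=\kappa_\alpha\,\mathcal{F}_{\alpha,q}^{-1}(|\lambda|^{2\alpha+1}\mathcal{F}_{\alpha,q}(f))$ on $\mathcal{S}_{*q,\alpha}(\mathbb{R}_q)$. *)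

theory Defs
  imports "HOL-Analysis.Analysis"
begin

definition qpoch :: "real \<Rightarrow> real \<Rightarrow> nat \<Rightarrow> real" where
  "qpoch a q n = (\<Prod>k<n. 1 - a * q ^ k)"

definition qpoch_inf :: "real \<Rightarrow> real \<Rightarrow> real" where
  "qpoch_inf a q = (\<Prod>k. 1 - a * q ^ k)"

definition q_Gamma :: "real \<Rightarrow> real \<Rightarrow> real" where
  "q_Gamma q x = qpoch_inf q q / qpoch_inf (q powr x) q * (1 - q) powr (1 - x)"

text \<open>The lattice \<open>\<real>\<^sub>q\<close>. Functions on it are represented by functions on the reals
  of which only the values on the lattice matter. The transforms below use no other values
  when evaluated on the lattice; \<open>q_deriv\<close> and the seminorms concern functions on all reals.\<close>

definition q_lattice :: "real \<Rightarrow> real set" where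
  "q_lattice q = range (\<lambda>n::int. q powi n) \<union> range (\<lambda>n::int. - (q powi n)) \<union> {0}"

text \<open>Jackson integrals over \<open>[0,a]\<close>, \<open>[0,\<infinity>[\<close> and \<open>[a,\<infinity>[\<close>. The sums are unconditional.\<close>

definition jackson :: "real \<Rightarrow> real \<Rightarrow> (real \<Rightarrow> complex) \<Rightarrow> complex" where
  "jackson q a f = ((1 - q) * a) *\<^sub>R (\<Sum>\<^sub>\<infinity>n::nat. q ^ n *\<^sub>R f (a * q ^ n))"

definition jackson_inf :: "real \<Rightarrow> (real \<Rightarrow> complex) \<Rightarrow> complex" where
  "jackson_inf q f = (1 - q) *\<^sub>R (\<Sum>\<^sub>\<infinity>n::int. (q powi n) *\<^sub>R f (q powi n))"

definition jackson_tail :: "real \<Rightarrow> real \<Rightarrow> (real \<Rightarrow> complex) \<Rightarrow> complex" where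
  "jackson_tail q a f = jackson_inf q f - jackson q a f"

definition q_deriv :: "real \<Rightarrow> (real \<Rightarrow> complex) \<Rightarrow> real \<Rightarrow> complex" where
  "q_deriv q f x =
     (if x = 0 then vector_derivative f (at 0)
      else (f x - f (q * x)) / complex_of_real ((1 - q) * x))"

text \<open>Away from 0 the iterated \<open>q\<close>-derivatives always exist, so only the point 0
  imposes a condition.\<close>

definition infinitely_q_differentiable :: "real \<Rightarrow> (real \<Rightarrow> complex) \<Rightarrow> bool" where
  "infinitely_q_differentiable q f \<longleftrightarrow> (\<forall>k. ((q_deriv q ^^ k) f) differentiable (at 0))"

definition q_seminorm :: "real \<Rightarrow> nat \<Rightarrow> nat \<Rightarrow> (real \<Rightarrow> complex) \<Rightarrow> ennreal" where
  "q_seminorm q n m f =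
     (SUP (x, k) \<in> UNIV \<times> {..n}. ennreal (cmod ((1 + x\<^sup>2) ^ m *\<^sub>R (q_deriv q ^^ k) f x)))"

definition q_schwartz :: "real \<Rightarrow> (real \<Rightarrow> complex) set" where
  "q_schwartz q = {f. \<exists>F. (\<forall>x. F (- x) = F x) \<and> infinitely_q_differentiable q F \<and>
     (\<forall>n m. q_seminorm q n m F < \<infinity>) \<and> (\<forall>x\<in>q_lattice q. f x = F x)}"

definition q_schwartz_moments :: "real \<Rightarrow> real \<Rightarrow> (real \<Rightarrow> complex) set" where
  "q_schwartz_moments q \<beta> = {f \<in> q_schwartz q.
     \<forall>k::nat. jackson_inf q (\<lambda>x. x powr (2 * real k + 2 * \<beta> + 1) *\<^sub>R f x) = 0}"

definition q_bessel3 :: "real \<Rightarrow> real \<Rightarrow> real \<Rightarrow> real" where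
  "q_bessel3 q \<beta> z =
     (\<Sum>n. (- 1) ^ n * q ^ (n * (n - 1)) * (1 - q) ^ (2 * n) * z ^ (2 * n)
            / (qpoch (q\<^sup>2) (q\<^sup>2) n * qpoch (q powr (2 * \<beta> + 2)) (q\<^sup>2) n))"

definition q_cos :: "real \<Rightarrow> real \<Rightarrow> real" where
  "q_cos q x = q_bessel3 q (- 1 / 2) x"

definition q_c :: "real \<Rightarrow> real \<Rightarrow> real" where
  "q_c q \<beta> = (1 + inverse q) powr (- \<beta>) / q_Gamma (q\<^sup>2) (\<beta> + 1)"

definition q_bessel_fourier ::
  "real \<Rightarrow> real \<Rightarrow> (real \<Rightarrow> complex) \<Rightarrow> real \<Rightarrow> complex" where
  "q_bessel_fourier q \<alpha> f l =
     q_c q \<alpha> *\<^sub>R jackson_inf q (\<lambda>x. (q_bessel3 q \<alpha> (l * x) * x powr (2 * \<alpha> + 1)) *\<^sub>R f x)"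

definition q_bessel_fourier_inv ::
  "real \<Rightarrow> real \<Rightarrow> (real \<Rightarrow> complex) \<Rightarrow> real \<Rightarrow> complex" where
  "q_bessel_fourier_inv q \<alpha> f l = q powr (- 4 * \<alpha> - 2) *\<^sub>R q_bessel_fourier q \<alpha> f l"

definition q_fourier_cos :: "real \<Rightarrow> (real \<Rightarrow> complex) \<Rightarrow> real \<Rightarrow> complex" where
  "q_fourier_cos q f l = q_c q (- 1 / 2) *\<^sub>R jackson_inf q (\<lambda>x. q_cos q (l * x) *\<^sub>R f x)"

definition q_fourier_cos_inv :: "real \<Rightarrow> (real \<Rightarrow> complex) \<Rightarrow> real \<Rightarrow> complex" where
  "q_fourier_cos_inv q = q_fourier_cos q"

definition q_riemann_liouville ::
  "real \<Rightarrow> real \<Rightarrow> (real \<Rightarrow> complex) \<Rightarrow> real \<Rightarrow> complex" where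
  "q_riemann_liouville q \<alpha> f x =
     ((1 + q) * q_Gamma (q\<^sup>2) (\<alpha> + 1) / (q_Gamma (q\<^sup>2) (1 / 2) * q_Gamma (q\<^sup>2) (\<alpha> + 1 / 2))) *\<^sub>R
     jackson q 1 (\<lambda>t.
       (qpoch_inf (t\<^sup>2 * q\<^sup>2) (q\<^sup>2) / qpoch_inf (t\<^sup>2 * q powr (2 * \<alpha> + 1)) (q\<^sup>2)) *\<^sub>R f (x * t))"

text \<open>The absolute value in the lower limit is the even extension from the nonnegative
  part of the lattice (the kernel only involves \<open>x\<^sup>2\<close>). If \<open>x = q\<^sup>k\<close>, the numerator of the
  kernel vanishes at \<open>t = q\<^sup>n\<close> for \<open>n > k\<close>; for half-integral \<open>\<alpha>\<close> the denominator may vanish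
  at such points too, but they contribute equally to both integrals in \<open>jackson_tail\<close>
  and so cancel.\<close>

definition q_weyl ::
  "real \<Rightarrow> real \<Rightarrow> (real \<Rightarrow> complex) \<Rightarrow> real \<Rightarrow> complex" where
  "q_weyl q \<alpha> f x =
     (q * (1 + inverse q) powr (- \<alpha> + 1 / 2) / q_Gamma (q\<^sup>2) (\<alpha> + 1 / 2)) *\<^sub>R
     jackson_tail q (q * \<bar>x\<bar>) (\<lambda>t.
       (qpoch_inf (q\<^sup>2 * x\<^sup>2 / t\<^sup>2) (q\<^sup>2) / qpoch_inf (q powr (2 * \<alpha> + 1) * x\<^sup>2 / t\<^sup>2) (q\<^sup>2)
         * t powr (2 * \<alpha>)) *\<^sub>R f t)"

definition q_kappa :: "real \<Rightarrow> real \<Rightarrow> real" where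
  "q_kappa q \<alpha> = q_Gamma (q\<^sup>2) (1 / 2) /
     (q powr (3 * \<alpha> + 3 / 2) * (1 + q) powr (\<alpha> + 1 / 2) * q_Gamma (q\<^sup>2) (\<alpha> + 1))"

definition q_K1 :: "real \<Rightarrow> real \<Rightarrow> (real \<Rightarrow> complex) \<Rightarrow> real \<Rightarrow> complex" where
  "q_K1 q \<alpha> f x = q_kappa q \<alpha> *\<^sub>R
     q_fourier_cos_inv q (\<lambda>l. \<bar>l\<bar> powr (2 * \<alpha> + 1) *\<^sub>R q_fourier_cos q f l) x"

definition q_K2 :: "real \<Rightarrow> real \<Rightarrow> (real \<Rightarrow> complex) \<Rightarrow> real \<Rightarrow> complex" where
  "q_K2 q \<alpha> f x = q_kappa q \<alpha> *\<^sub>R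
     q_bessel_fourier_inv q \<alpha> (\<lambda>l. \<bar>l\<bar> powr (2 * \<alpha> + 1) *\<^sub>R q_bessel_fourier q \<alpha> f l) x"

end

theory Submission
  imports Defs
begin

text \<open>
On the lattice every operator of the theorem is a discrete sum, and the theorem is a statement about
double-sided sequences. Write \<open>p = q\<^sup>2\<close>, \<open>b = q\<^bsup>2\<alpha>+1\<^esup>\<close> and \<open>w = b q\<close>. Since \<open>ln (1 - q) / ln q\<close> is an
integer \<open>s\<close>, the factor \<open>1 - q = q\<^sup>s\<close> in the argument of the \<open>q\<close>-Bessel function is itself a lattice
point, so the kernel of the \<open>q\<close>-Bessel Fourier transform is the shift by \<open>s\<close> of the sequence
\<open>\<phi>\<^sub>w(k) = (w;p)\<^sub>\<infinity> \<^sub>1\<phi>\<^sub>1(0; w; p, p\<^sup>k)\<close>, up to a constant; the \<open>q\<close>-cosine is the case \<open>w = q\<close>.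

All that is needed about \<open>\<phi>\<^sub>w\<close> can be read off its generating function, which by the \<open>q\<close>-binomial
theorem is \<open>\<Phi>\<^sub>w(y) = \<Sum>\<^sub>k \<phi>\<^sub>w(k) y\<^sup>k = y (p;p)\<^sub>\<infinity> (w/y;p)\<^sub>\<infinity> / (y;p)\<^sub>\<infinity>\<close> for \<open>0 < y < 1\<close>.

\<^item> The product \<open>\<Phi>\<^sub>w(y) \<Phi>\<^sub>w(w/y)\<close> is constant. This is the orthogonality relation
  (\<open>bessel_lat_orthogonality\<close>), and hence the \<open>q\<close>-Bessel Fourier transform is, up to a constant,
  an involution (\<open>hankel_hankel\<close>).

\<^item> The \<open>q\<close>-Riemann-Liouville and the \<open>q\<close>-Weyl transform are convolutions with the same sequence
  \<open>(b;p)\<^sub>j / (p;p)\<^sub>j\<close>, in opposite directions. The first maps the cosine kernel to the Bessel kernel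
  (\<open>kernel_raising\<close>), the second maps the weighted Bessel kernel to the cosine kernel
  (\<open>kernel_lowering\<close>).

Let \<open>g\<close> be the \<open>q\<close>-Bessel Fourier transform of \<open>f\<close>. Up to constants, both \<open>K\<^sub>1 (W f)\<close> and \<open>W (K\<^sub>2 f)\<close>
are the cosine transform of \<open>\<lambda>\<^bsup>2\<alpha>+1\<^esup> g\<close>: in the first case because the cosine transform of \<open>W f\<close> is
\<open>g\<close>, which is \<open>kernel_raising\<close> after an interchange of sums, in the second case by
\<open>kernel_lowering\<close>. By \<open>kernel_raising\<close> once more, \<open>R\<close> maps this cosine transform to the \<open>q\<close>-Bessel
Fourier transform of \<open>g\<close>, which is a multiple of \<open>f\<close>. The constants multiply to 1.

The analytic content is the justification of the interchanges, which all reduce to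
\<open>\<Sum>\<^sub>k w\<^sup>k |a(k)| < \<infinity>\<close> for \<open>a = f\<close> and for \<open>a = g\<close>. For \<open>f\<close> this is the decay in the definition of the
Schwartz space. For \<open>g\<close> the point is \<open>\<Phi>\<^sub>w(w) = 0\<close>: the transform annihilates constants, so \<open>f\<close> may be
replaced by \<open>f - f(0) = O(x)\<close>, and this gains the power of \<open>q\<close> that makes the sum converge
(\<open>hankel_weighted_summable\<close>). The point 0 of the lattice is reached as a limit.
\<close>

section \<open>Rearranging unconditional sums\<close>

text \<open>The dominating family is given together with its row sums because in several uses these are known in
closed form while the family is not a product of two sequences.\<close>

lemma summable_on_rows:
  fixes f :: "'a \<Rightarrow> 'b \<Rightarrow> 'c :: banach"
  assumes rows: "\<And>x. (F x has_sum g x) UNIV" and g: "g summable_on UNIV"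
    and bound: "\<And>x y. norm (f x y) \<le> F x y"
  shows "(\<lambda>(x, y). f x y) summable_on UNIV"
proof -
  have F_nonneg: "0 \<le> F x y" for x y
    using bound[of x y] norm_ge_zero[of "f x y"] by linarith
  have "(\<lambda>(x, y). F x y) summable_on Sigma UNIV (\<lambda>_. UNIV)"
    by (rule summable_on_SigmaI[where g = g]) (use rows g F_nonneg in auto)
  then have "(\<lambda>z. norm (case z of (x, y) \<Rightarrow> f x y)) summable_on Sigma UNIV (\<lambda>_. UNIV)"
    by (rule Infinite_Sum.abs_summable_on_comparison_test') (use bound in auto)
  then show ?thesis
    by (simp add: abs_summable_summable)
qed

lemma summable_on_product_bound:
  fixes f :: "'a \<Rightarrow> 'b \<Rightarrow> 'c :: banach" and a :: "'a \<Rightarrow> real"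
  assumes "a summable_on UNIV" "b summable_on UNIV"
    and "\<And>x y. norm (f x y) \<le> a x * b y"
  shows "(\<lambda>(x, y). f x y) summable_on UNIV"
proof (rule summable_on_rows)
  show "((\<lambda>y. a x * b y) has_sum (a x * infsum b UNIV)) UNIV" for x
    by (intro has_sum_cmult_right has_sum_infsum assms)
  show "(\<lambda>x. a x * infsum b UNIV) summable_on UNIV"
    by (intro summable_on_cmult_left assms)
qed (rule assms)

lemma infsum_swap_UNIV:
  fixes f :: "'a \<Rightarrow> 'b \<Rightarrow> 'c :: banach"
  assumes "(\<lambda>(x, y). f x y) summable_on UNIV"
  shows "(\<Sum>\<^sub>\<infinity>x. \<Sum>\<^sub>\<infinity>y. f x y) = (\<Sum>\<^sub>\<infinity>y. \<Sum>\<^sub>\<infinity>x. f x y)"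
  by (rule infsum_swap_banach) (use assms in simp)

text \<open>Double sums over \<open>\<int> \<times> \<nat>\<close> in this development become summable only after one variable is shifted by an
amount depending on the other; the shear \<open>(k, i) \<mapsto> (k + \<sigma> i, i)\<close> is a bijection.\<close>

lemma infsum_sheared:
  fixes c :: "int \<Rightarrow> nat \<Rightarrow> 'c :: banach" and \<sigma> :: "nat \<Rightarrow> int"
  assumes S: "(\<lambda>(m, i). c m i) summable_on UNIV"
  shows "(\<Sum>\<^sub>\<infinity>k. \<Sum>\<^sub>\<infinity>i. c (k + \<sigma> i) i) = (\<Sum>\<^sub>\<infinity>m. \<Sum>\<^sub>\<infinity>i. c m i)"
    and "(\<lambda>k. \<Sum>\<^sub>\<infinity>i. c (k + \<sigma> i) i) summable_on UNIV"
proof -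
  have bij: "bij_betw (\<lambda>(k, i). (k + \<sigma> i, i)) UNIV UNIV"
    by (rule bij_betwI[where g = "\<lambda>(m, i). (m - \<sigma> i, i)"]) auto
  have eq: "(\<lambda>z. case (case z of (k, i) \<Rightarrow> (k + \<sigma> i, i)) of (m, i) \<Rightarrow> c m i)
      = (\<lambda>(k, i). c (k + \<sigma> i) i)"
    by auto
  have S': "(\<lambda>(k, i). c (k + \<sigma> i) i) summable_on UNIV"
    using summable_on_reindex_bij_betw[OF bij, of "\<lambda>(m, i). c m i"] S by (simp add: eq)
  have I: "infsum (\<lambda>(k, i). c (k + \<sigma> i) i) UNIV = infsum (\<lambda>(m, i). c m i) UNIV"
    using infsum_reindex_bij_betw[OF bij, of "\<lambda>(m, i). c m i"] by (simp add: eq)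
  have T: "(\<Sum>\<^sub>\<infinity>m. \<Sum>\<^sub>\<infinity>i. d m i) = infsum (\<lambda>(m, i). d m i) UNIV"
    if "(\<lambda>(m, i). d m i) summable_on UNIV" for d :: "int \<Rightarrow> nat \<Rightarrow> 'c"
    using infsum_Sigma'_banach[of d UNIV "\<lambda>_. UNIV"] that by simp
  show "(\<Sum>\<^sub>\<infinity>k. \<Sum>\<^sub>\<infinity>i. c (k + \<sigma> i) i) = (\<Sum>\<^sub>\<infinity>m. \<Sum>\<^sub>\<infinity>i. c m i)"
    by (simp add: T[OF S] T[OF S'] I)
  show "(\<lambda>k. \<Sum>\<^sub>\<infinity>i. c (k + \<sigma> i) i) summable_on UNIV"
    using summable_on_Sigma_banach[of "\<lambda>k i. c (k + \<sigma> i) i" UNIV "\<lambda>_. UNIV"] S' by simp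
qed

lemma summable_on_bounded_mult:
  fixes a :: "'a \<Rightarrow> real" and f :: "'a \<Rightarrow> 'c :: banach"
  assumes "a summable_on A" "\<And>x. x \<in> A \<Longrightarrow> norm (f x) \<le> a x * K"
  shows "f summable_on A"
  using Infinite_Sum.abs_summable_on_comparison_test'[OF summable_on_cmult_left[OF assms(1), of K] assms(2)]
  by (rule abs_summable_summable)

lemma infsum_int_shift:
  fixes f :: "int \<Rightarrow> 'a :: {comm_monoid_add, t2_space}"
  shows "(\<Sum>\<^sub>\<infinity>k. f (k + n)) = infsum f UNIV"
    and "(\<lambda>k. f (k + n)) summable_on UNIV \<longleftrightarrow> f summable_on UNIV"
proof -
  have bij: "bij_betw (\<lambda>k::int. k + n) UNIV UNIV"
    by (rule bij_betwI[where g = "\<lambda>k. k - n"]) auto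
  show "(\<Sum>\<^sub>\<infinity>k. f (k + n)) = infsum f UNIV"
    by (rule infsum_reindex_bij_betw[OF bij])
  show "(\<lambda>k. f (k + n)) summable_on UNIV \<longleftrightarrow> f summable_on UNIV"
    by (rule summable_on_reindex_bij_betw[OF bij])
qed

text \<open>An enumeration of \<open>\<int>\<close> reduces this to Tannery's theorem for ordinary series.\<close>

lemma infsum_int_dominated_convergence:
  fixes a :: "int \<Rightarrow> nat \<Rightarrow> 'a :: {real_normed_algebra, banach}"
  assumes lim: "\<And>k. (\<lambda>n. a k n) \<longlonglongrightarrow> b k"
    and bound: "\<And>k n. norm (a k n) \<le> M k" and M: "M summable_on UNIV"
  shows "(\<lambda>n. \<Sum>\<^sub>\<infinity>k. a k n) \<longlonglongrightarrow> (\<Sum>\<^sub>\<infinity>k. b k)"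
proof -
  have conv: "(\<Sum>\<^sub>\<infinity>k. f k) = (\<Sum>i. f (int_decode i)) \<and> summable (\<lambda>i. M (int_decode i))"
    if "\<And>k. norm (f k) \<le> M k" for f :: "int \<Rightarrow> 'a"
  proof -
    have "f summable_on UNIV"
      using Infinite_Sum.abs_summable_on_comparison_test'[OF M that] by (rule abs_summable_summable)
    then have "(\<lambda>i. f (int_decode i)) summable_on UNIV"
      by (simp add: summable_on_reindex_bij_betw[OF bij_int_decode])
    then have "(\<Sum>i. f (int_decode i)) = (\<Sum>\<^sub>\<infinity>i. f (int_decode i))"
      using has_sum_imp_sums[OF has_sum_infsum] sums_unique by metis
    moreover have "(\<lambda>i. M (int_decode i)) summable_on UNIV"
      using M by (simp add: summable_on_reindex_bij_betw[OF bij_int_decode])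
    ultimately show ?thesis
      by (simp add: infsum_reindex_bij_betw[OF bij_int_decode] summable_on_imp_summable)
  qed
  have b: "norm (b k) \<le> M k" for k
    using LIMSEQ_le_const2[OF tendsto_norm[OF lim[of k]]] bound by blast
  have "eventually (\<lambda>(i, n). norm (a (int_decode i) n) \<le> M (int_decode i)) (at_top \<times>\<^sub>F sequentially)"
    using bound by (intro always_eventually) auto
  then have "(\<lambda>n. \<Sum>i. a (int_decode i) n) \<longlonglongrightarrow> (\<Sum>i. b (int_decode i))"
    using tannerys_theorem[where a = "\<lambda>i n. a (int_decode i) n" and b = "\<lambda>i. b (int_decode i)"
        and M = "\<lambda>i. M (int_decode i)" and F = sequentially] lim bound conv[of b, OF b]
    by simp
  then show ?thesis
    using conv[of b, OF b] conv[of "\<lambda>k. a k n" for n, OF bound] by simp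
qed

text \<open>For \<open>c \<noteq> 0\<close> the two sums exist or fail to exist together, as \<open>f x\<close> can be recovered from \<open>f x *\<^sub>R c\<close>.\<close>

lemma infsum_scaleR_left_complex:
  fixes f :: "'a \<Rightarrow> real" and c :: complex
  shows "infsum (\<lambda>x. f x *\<^sub>R c) A = infsum f A *\<^sub>R c"
proof (cases "c = 0 \<or> f summable_on A")
  case True
  then show ?thesis by (cases "c = 0") (simp_all add: infsum_scaleR_left)
next
  case False
  have "\<not> (\<lambda>x. f x *\<^sub>R c) summable_on A"
  proof
    assume "(\<lambda>x. f x *\<^sub>R c) summable_on A"
    then have "(\<lambda>x. complex_of_real (f x)) summable_on A"
      using False by (simp add: scaleR_conv_of_real summable_on_cmult_left')
    then have "(\<lambda>x. Re (complex_of_real (f x))) summable_on A"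
      by (rule summable_on_Re)
    then show False using False by simp
  qed
  then show ?thesis using False by (simp add: infsum_not_exists)
qed

text \<open>On the lattice, decay at both ends appears as two exponential bounds, one useful for positive and one
for negative exponents.\<close>

lemma summable_on_int_two_sided:
  fixes f :: "int \<Rightarrow> 'a :: banach"
  assumes y: "0 < y" "y < 1" and z: "1 < z"
    and bound_y: "\<And>m. norm (f m) \<le> K * y powi m" and bound_z: "\<And>m. norm (f m) \<le> K' * z powi m"
  shows "(\<lambda>m. norm (f m)) summable_on UNIV"
proof -
  have geom: "(\<lambda>n. r ^ n) summable_on UNIV" if "0 < r" "r < 1" for r :: real
    using that by (simp add: summable_on_UNIV_nonneg_real_iff summable_geometric)
  have "(\<lambda>n. norm (f (int n))) summable_on UNIV"
  proof (rule summable_on_bounded_mult[OF geom[OF y], where K = K])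
    show "norm (norm (f (int n))) \<le> y ^ n * K" for n
      using bound_y[of "int n"] by (simp add: mult.commute)
  qed
  then have 1: "(\<lambda>m. norm (f m)) summable_on range int"
    by (subst summable_on_reindex) (simp_all add: o_def)
  have "(\<lambda>n. norm (f (- int n))) summable_on UNIV"
  proof (rule summable_on_bounded_mult[OF geom[of "1 / z"], where K = K'])
    show "norm (norm (f (- int n))) \<le> (1 / z) ^ n * K'" for n
      using bound_z[of "- int n"] by (simp add: power_int_minus power_one_over inverse_eq_divide)
  qed (use z in auto)
  then have 2: "(\<lambda>m. norm (f m)) summable_on range (\<lambda>n. - int n)"
    by (subst summable_on_reindex) (simp_all add: o_def inj_on_def)
  have "UNIV = range int \<union> range (\<lambda>n. - int n)"
  proof (intro equalityI subsetI)
    fix m :: int assume "m \<in> UNIV"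
    show "m \<in> range int \<union> range (\<lambda>n. - int n)"
      by (cases m rule: int_cases2) auto
  qed simp
  then show ?thesis using summable_on_union[OF 1 2] by simp
qed

lemma powi_powr:
  fixes x y :: real
  assumes "x > 0"
  shows "(x powi k) powr y = (x powr y) powi k"
  using assms by (simp add: powr_real_of_int' [symmetric] powr_powr mult.commute)

section \<open>Shifted factorials and the q-binomial theorem\<close>

locale q_base =
  fixes p :: real
  assumes p_pos: "0 < p" and p_less: "p < 1"

text \<open>The coefficients of \<open>(B y;p)\<^sub>\<infinity> / (A y;p)\<^sub>\<infinity>\<close> as a power series in \<open>y\<close>. The homogeneous form treats both
\<open>q\<close>-exponentials (\<open>A = 0\<close> or \<open>B = 0\<close>) and the kernel of the fractional integrals (\<open>A = 1\<close>) at once.\<close>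

definition qbinom_coeff :: "real \<Rightarrow> real \<Rightarrow> real \<Rightarrow> nat \<Rightarrow> real" where
  "qbinom_coeff p A B n = (\<Prod>k<n. (A - B * p ^ k) / (1 - p ^ Suc k))"

context q_base
begin

lemma power_Suc_less_1: "p ^ Suc n < 1"
  by (rule power_Suc_less_one[OF p_pos p_less])

lemma convergent_prod_qpoch: "convergent_prod (\<lambda>k. 1 - a * p ^ k)"
proof -
  have "summable (\<lambda>k. norm (a * p ^ k))"
    using p_pos p_less by (simp add: abs_mult power_abs summable_geometric summable_mult)
  then have "abs_convergent_prod (\<lambda>k. 1 - a * p ^ k)"
    by (intro summable_imp_abs_convergent_prod) simp
  then show ?thesis by (rule abs_convergent_prod_imp_convergent_prod)
qed

lemma qpoch_tendsto_qpoch_inf: "(\<lambda>n. qpoch a p n) \<longlonglongrightarrow> qpoch_inf a p"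
proof -
  have "(\<lambda>n. \<Prod>k\<le>n. 1 - a * p ^ k) \<longlonglongrightarrow> qpoch_inf a p"
    unfolding qpoch_inf_def by (rule convergent_prod_LIMSEQ[OF convergent_prod_qpoch])
  then have "(\<lambda>n. qpoch a p (Suc n)) \<longlonglongrightarrow> qpoch_inf a p"
    by (simp add: qpoch_def lessThan_Suc_atMost)
  then show ?thesis by (rule LIMSEQ_imp_Suc)
qed

text \<open>All values of infinite products at lattice points are compared through this identity.\<close>

lemma qpoch_inf_split: "qpoch_inf a p = qpoch a p n * qpoch_inf (a * p ^ n) p"
proof -
  have "qpoch a p (n + m) = qpoch a p n * qpoch (a * p ^ n) p m" for m
    by (induction m) (simp_all add: qpoch_def power_add algebra_simps)
  then have "(\<lambda>m. qpoch a p (m + n)) \<longlonglongrightarrow> qpoch a p n * qpoch_inf (a * p ^ n) p"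
    using tendsto_mult_left[OF qpoch_tendsto_qpoch_inf] by (simp add: add.commute)
  then show ?thesis
    using LIMSEQ_ignore_initial_segment[OF qpoch_tendsto_qpoch_inf] LIMSEQ_unique by blast
qed

lemma qpoch_inf_0 [simp]: "qpoch_inf 0 p = 1"
  by (simp add: qpoch_inf_def)

lemma qpoch_inf_1 [simp]: "qpoch_inf 1 p = 0"
  using qpoch_inf_split[of 1 1] by (simp add: qpoch_def)

lemma qpoch_inf_pos:
  assumes "a < 1"
  shows "qpoch_inf a p > 0"
proof -
  have "a * p ^ k < 1" for k
  proof (cases "a \<le> 0")
    case True
    then have "a * p ^ k \<le> 0" using p_pos by (simp add: mult_nonpos_nonneg)
    then show ?thesis by linarith
  next
    case False
    have "a * p ^ k \<le> a * 1"
      using False p_pos p_less by (intro mult_left_mono power_le_one) auto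
    then show ?thesis using assms by linarith
  qed
  then show ?thesis
    unfolding qpoch_inf_def by (intro less_0_prodinf convergent_prod_qpoch) auto
qed

lemma qpoch_le_1:
  assumes "0 \<le> a" "a \<le> 1"
  shows "0 \<le> qpoch a p n" "qpoch a p n \<le> 1"
proof -
  have *: "0 \<le> a * p ^ k \<and> a * p ^ k \<le> 1" for k
    using assms p_pos p_less by (simp add: mult_le_one power_le_one)
  show "0 \<le> qpoch a p n" unfolding qpoch_def using * by (intro prod_nonneg) auto
  show "qpoch a p n \<le> 1" unfolding qpoch_def using * by (intro prod_le_1) auto
qed

lemma qpoch_inf_bounds:
  assumes "0 \<le> a" "a \<le> 1"
  shows "0 \<le> qpoch_inf a p" "qpoch_inf a p \<le> 1"
  using LIMSEQ_le_const[OF qpoch_tendsto_qpoch_inf] LIMSEQ_le_const2[OF qpoch_tendsto_qpoch_inf]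
    qpoch_le_1[OF assms] by blast+

lemma qpoch_pos:
  assumes "a < 1"
  shows "qpoch a p n > 0"
proof -
  have "qpoch_inf a p \<noteq> 0" using qpoch_inf_pos[OF assms] by simp
  moreover have "qpoch (max a 0) p n \<ge> 0" using assms by (intro qpoch_le_1) auto
  moreover have "qpoch (max a 0) p n \<le> qpoch a p n"
    unfolding qpoch_def
  proof (intro prod_mono conjI)
    fix k
    have "max a 0 * p ^ k \<le> 1"
      using assms p_pos p_less by (intro mult_le_one power_le_one) auto
    then show "0 \<le> 1 - max a 0 * p ^ k" by simp
    show "1 - max a 0 * p ^ k \<le> 1 - a * p ^ k"
      using p_pos by (simp add: mult_right_mono)
  qed
  ultimately show ?thesis using qpoch_inf_split[of a n] by (cases "qpoch a p n = 0") auto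
qed

lemma qbinom_coeff_0 [simp]: "qbinom_coeff p A B 0 = 1"
  by (simp add: qbinom_coeff_def)

lemma qbinom_coeff_Suc:
  "(1 - p ^ Suc n) * qbinom_coeff p A B (Suc n) = (A - B * p ^ n) * qbinom_coeff p A B n"
  using power_Suc_less_1[of n] by (simp add: qbinom_coeff_def field_simps)

text \<open>The variable of the generating function is absorbed into the parameters, so that it never has to be
carried along.\<close>

lemma qbinom_coeff_scale: "qbinom_coeff p (c * A) (c * B) n = c ^ n * qbinom_coeff p A B n"
proof -
  have "(c * A - c * B * p ^ k) / (1 - p ^ Suc k) = c * ((A - B * p ^ k) / (1 - p ^ Suc k))" for k
    by (simp add: right_diff_distrib mult.assoc)
  then show ?thesis
    unfolding qbinom_coeff_def by (simp only: prod.distrib prod_constant card_lessThan)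
qed

lemma qbinom_coeff_diag: "qbinom_coeff p 0 0 n = (if n = 0 then 1 else 0)"
  by (cases n) (simp_all add: qbinom_coeff_def)

lemma qbinom_coeff_1_0: "qbinom_coeff p 1 0 n = 1 / qpoch p p n"
  by (simp add: qbinom_coeff_def qpoch_def prod_dividef)

lemma qbinom_coeff_1: "qbinom_coeff p 1 b n = qpoch b p n / qpoch p p n"
  by (simp add: qbinom_coeff_def qpoch_def prod_dividef)

lemma qbinom_coeff_0_1: "qbinom_coeff p 0 1 n = (- 1) ^ n * p ^ (n choose 2) / qpoch p p n"
proof (induction n)
  case (Suc n)
  have "Suc n choose 2 = n + (n choose 2)"
    by (simp add: numeral_2_eq_2)
  then show ?case using Suc
    by (simp add: qbinom_coeff_def qpoch_def power_add)
qed (simp add: qpoch_def numeral_2_eq_2)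

text \<open>This is \<open>(B y)\<^sub>\<infinity>/(A y)\<^sub>\<infinity> \<cdot> (C y)\<^sub>\<infinity>/(B y)\<^sub>\<infinity> = (C y)\<^sub>\<infinity>/(A y)\<^sub>\<infinity>\<close> on the level of coefficients. The induction rests on
\<open>1 - p\<^sup>n = (1 - p\<^sup>j) + p\<^sup>j (1 - p\<^bsup>n-j\<^esup>)\<close>, which splits the left-hand side into two sums that the recurrence for
the coefficients shifts back to \<open>n - 1\<close>.\<close>

lemma qbinom_coeff_convolution:
  "(\<Sum>j\<le>n. qbinom_coeff p A B j * qbinom_coeff p B C (n - j)) = qbinom_coeff p A C n"
proof (induction n)
  case (Suc n)
  let ?f = "qbinom_coeff p A B" and ?g = "qbinom_coeff p B C"
  have split: "(1 - p ^ Suc n) * (?f j * ?g (Suc n - j))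
      = (1 - p ^ j) * ?f j * ?g (Suc n - j) + p ^ j * ?f j * ((1 - p ^ (Suc n - j)) * ?g (Suc n - j))"
    if "j \<le> Suc n" for j
  proof -
    have "p ^ Suc n = p ^ j * p ^ (Suc n - j)"
      using that by (simp flip: power_add)
    then show ?thesis by (simp only:) (simp add: algebra_simps)
  qed
  have "(1 - p ^ Suc n) * (\<Sum>j\<le>Suc n. ?f j * ?g (Suc n - j))
      = (\<Sum>j\<le>Suc n. (1 - p ^ j) * ?f j * ?g (Suc n - j))
        + (\<Sum>j\<le>Suc n. p ^ j * ?f j * ((1 - p ^ (Suc n - j)) * ?g (Suc n - j)))"
    unfolding sum_distrib_left sum.distrib[symmetric] by (intro sum.cong split) auto
  also have "(\<Sum>j\<le>Suc n. (1 - p ^ j) * ?f j * ?g (Suc n - j))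
      = (\<Sum>j\<le>n. (1 - p ^ Suc j) * ?f (Suc j) * ?g (n - j))"
    by (subst sum.atMost_Suc_shift) simp
  also have "\<dots> = (\<Sum>j\<le>n. (A - B * p ^ j) * ?f j * ?g (n - j))"
    by (simp only: qbinom_coeff_Suc)
  also have "(\<Sum>j\<le>Suc n. p ^ j * ?f j * ((1 - p ^ (Suc n - j)) * ?g (Suc n - j)))
      = (\<Sum>j\<le>n. p ^ j * ?f j * ((1 - p ^ Suc (n - j)) * ?g (Suc (n - j))))"
    by (simp add: Suc_diff_le)
  also have "\<dots> = (\<Sum>j\<le>n. p ^ j * ?f j * ((B - C * p ^ (n - j)) * ?g (n - j)))"
    by (simp only: qbinom_coeff_Suc)
  also have "(\<Sum>j\<le>n. (A - B * p ^ j) * ?f j * ?g (n - j))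
        + (\<Sum>j\<le>n. p ^ j * ?f j * ((B - C * p ^ (n - j)) * ?g (n - j)))
      = (\<Sum>j\<le>n. (A - C * p ^ n) * (?f j * ?g (n - j)))"
    unfolding sum.distrib[symmetric]
  proof (intro sum.cong refl)
    fix j assume "j \<in> {..n}"
    then have "p ^ n = p ^ j * p ^ (n - j)" by (simp flip: power_add)
    then show "(A - B * p ^ j) * ?f j * ?g (n - j) + p ^ j * ?f j * ((B - C * p ^ (n - j)) * ?g (n - j))
        = (A - C * p ^ n) * (?f j * ?g (n - j))"
      by (simp add: algebra_simps)
  qed
  also have "\<dots> = (1 - p ^ Suc n) * qbinom_coeff p A C (Suc n)"
    by (simp only: sum_distrib_left[symmetric] Suc qbinom_coeff_Suc)
  finally show ?case using power_Suc_less_1[of n] by simp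
qed simp

lemma summable_qbinom_coeff:
  assumes "\<bar>A\<bar> < 1"
  shows "summable (\<lambda>n. \<bar>qbinom_coeff p A B n\<bar>)"
proof -
  obtain c where c: "\<bar>A\<bar> < c" "c < 1" using assms dense by blast
  have pn: "(\<lambda>n. p ^ n) \<longlonglongrightarrow> 0"
    using p_pos p_less by (simp add: LIMSEQ_power_zero)
  have "(\<lambda>n. \<bar>(A - B * p ^ n) / (1 - p ^ Suc n)\<bar>) \<longlonglongrightarrow> \<bar>(A - B * 0) / (1 - 0)\<bar>"
    by (intro tendsto_intros pn LIMSEQ_Suc[OF pn]) simp
  then have "eventually (\<lambda>n. \<bar>(A - B * p ^ n) / (1 - p ^ Suc n)\<bar> < c) sequentially"
    using c by (intro order_tendstoD(2)) auto
  then obtain N where N: "\<And>n. n \<ge> N \<Longrightarrow> \<bar>(A - B * p ^ n) / (1 - p ^ Suc n)\<bar> < c"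
    by (auto simp: eventually_sequentially)
  show ?thesis
  proof (rule summable_ratio_test[OF c(2)])
    fix n assume "n \<ge> N"
    have "\<bar>qbinom_coeff p A B (Suc n)\<bar> = \<bar>(A - B * p ^ n) / (1 - p ^ Suc n)\<bar> * \<bar>qbinom_coeff p A B n\<bar>"
      by (simp add: qbinom_coeff_def abs_mult)
    also have "\<dots> \<le> c * \<bar>qbinom_coeff p A B n\<bar>"
      using N[OF \<open>n \<ge> N\<close>] by (intro mult_right_mono) auto
    finally show "norm \<bar>qbinom_coeff p A B (Suc n)\<bar> \<le> c * norm \<bar>qbinom_coeff p A B n\<bar>" by simp
  qed
qed

text \<open>The \<open>q\<close>-binomial theorem. The recurrence for the coefficients gives the functional equation
\<open>(1 - A y) f(y) = (1 - B y) f(p y)\<close> for the power series \<open>f\<close>; iterating it from \<open>y = 1\<close> pushes the argument to 0,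
where \<open>f\<close> is continuous with value 1.\<close>

lemma qbinomial_sums:
  assumes A: "\<bar>A\<bar> < 1"
  shows "qbinom_coeff p A B sums (qpoch_inf B p / qpoch_inf A p)"
proof -
  let ?c = "qbinom_coeff p A B"
  define f where "f y = (\<Sum>n. ?c n * y ^ n)" for y
  have abs1: "summable (\<lambda>n. \<bar>?c n\<bar>)" by (rule summable_qbinom_coeff[OF A])
  have summ: "summable (\<lambda>n. ?c n * y ^ n)" if "0 \<le> y" "y \<le> 1" for y
  proof (rule summable_comparison_test'[OF abs1])
    fix n show "norm (?c n * y ^ n) \<le> \<bar>?c n\<bar>"
      using that by (simp add: abs_mult power_abs mult_left_le power_le_one)
  qed
  have func: "(1 - A * y) * f y = (1 - B * y) * f (p * y)" if y: "0 \<le> y" "y \<le> 1" for y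
  proof -
    have py: "0 \<le> p * y" "p * y \<le> 1"
      using y p_pos p_less by (auto simp: mult_le_one)
    have s1: "summable (\<lambda>n. (1 - p ^ n) * ?c n * y ^ n)"
      using summable_diff[OF summ[OF y] summ[OF py]]
      by (simp add: algebra_simps power_mult_distrib)
    have "f y - f (p * y) = (\<Sum>n. (1 - p ^ n) * ?c n * y ^ n)"
      unfolding f_def using suminf_diff[OF summ[OF y] summ[OF py]]
      by (simp add: algebra_simps power_mult_distrib)
    also have "\<dots> = (\<Sum>n. (1 - p ^ Suc n) * ?c (Suc n) * y ^ Suc n)"
      using suminf_split_head[OF s1] by simp
    also have "\<dots> = (\<Sum>n. y * (A * (?c n * y ^ n) - B * (?c n * (p * y) ^ n)))"
      by (simp only: qbinom_coeff_Suc) (simp add: algebra_simps power_mult_distrib)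
    also have "\<dots> = y * (A * f y - B * f (p * y))"
      unfolding f_def using summ[OF y] summ[OF py]
      by (simp add: suminf_mult suminf_diff[symmetric] summable_mult summable_diff)
    finally show ?thesis by (simp add: algebra_simps)
  qed
  have iter: "qpoch A p n * f 1 = qpoch B p n * f (p ^ n)" for n
  proof (induction n)
    case (Suc n)
    have "qpoch A p (Suc n) * f 1 = (1 - A * p ^ n) * (qpoch A p n * f 1)"
      by (simp add: qpoch_def)
    also have "\<dots> = qpoch B p n * ((1 - A * p ^ n) * f (p ^ n))"
      using Suc by simp
    also have "(1 - A * p ^ n) * f (p ^ n) = (1 - B * p ^ n) * f (p ^ Suc n)"
      using func[of "p ^ n"] p_pos p_less by (simp add: power_le_one)
    finally show ?case by (simp add: qpoch_def)
  qed (simp add: qpoch_def)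
  have "isCont f 0"
    unfolding f_def using summ[of 1] by (intro isCont_powser[where K = 1]) auto
  moreover have "(\<lambda>n. p ^ n) \<longlonglongrightarrow> 0"
    using p_pos p_less by (simp add: LIMSEQ_power_zero)
  ultimately have "(\<lambda>n. f (p ^ n)) \<longlonglongrightarrow> f 0"
    by (rule isCont_tendsto_compose)
  moreover have "f 0 = 1"
    unfolding f_def by simp
  ultimately have "(\<lambda>n. qpoch B p n * f (p ^ n)) \<longlonglongrightarrow> qpoch_inf B p * 1"
    by (intro tendsto_mult qpoch_tendsto_qpoch_inf) simp
  moreover have "(\<lambda>n. qpoch A p n * f 1) \<longlonglongrightarrow> qpoch_inf A p * f 1"
    by (intro tendsto_mult qpoch_tendsto_qpoch_inf) simp
  ultimately have "qpoch_inf A p * f 1 = qpoch_inf B p"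
    using iter LIMSEQ_unique by force
  moreover have "qpoch_inf A p > 0" using A by (intro qpoch_inf_pos) auto
  ultimately have "f 1 = qpoch_inf B p / qpoch_inf A p" by (simp add: field_simps)
  moreover have "?c sums f 1"
    unfolding f_def using summable_sums[OF summ[of 1]] by simp
  ultimately show ?thesis by simp
qed

lemma qbinomial_has_sum:
  assumes "\<bar>A\<bar> < 1"
  shows "(qbinom_coeff p A B has_sum (qpoch_inf B p / qpoch_inf A p)) UNIV"
  using norm_summable_imp_has_sum[OF _ qbinomial_sums[OF assms]] summable_qbinom_coeff[OF assms]
  by simp

lemma abs_summable_qbinom_coeff:
  assumes "\<bar>A\<bar> < 1"
  shows "(\<lambda>n. \<bar>qbinom_coeff p A B n\<bar>) summable_on UNIV"
  using summable_qbinom_coeff[OF assms] by (simp add: summable_on_UNIV_nonneg_real_iff)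

end

section \<open>The Bessel function on the lattice\<close>

text \<open>The big \<open>q\<close>-exponential \<open>(z;p)\<^sub>\<infinity>\<close> at the lattice point \<open>z = p\<^sup>m\<close>.\<close>

definition qexp_lat :: "real \<Rightarrow> int \<Rightarrow> real" where
  "qexp_lat p m = qpoch_inf (p powi m) p"

text \<open>The sequence \<open>(w;p)\<^sub>\<infinity> \<^sub>1\<phi>\<^sub>1(0; w; p, p\<^sup>k)\<close>, in the form obtained by exchanging the roles of parameter and
argument (see \<open>bessel_series_lattice\<close>). In this form the super-exponential decay for
\<open>k \<rightarrow> -\<infinity>\<close> is visible: the terms with \<open>k + i \<le> 0\<close> vanish.\<close>

definition bessel_lat :: "real \<Rightarrow> real \<Rightarrow> int \<Rightarrow> real" where
  "bessel_lat p w k = (\<Sum>\<^sub>\<infinity>i::nat. qbinom_coeff p 0 w i * qexp_lat p (k + int i))"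

context q_base
begin

text \<open>One of the factors of the product is \<open>1 - 1\<close>.\<close>

lemma qexp_lat_nonpos: 
  assumes "m \<le> 0"
  shows "qexp_lat p m = 0"
proof -
  have "p powi m * p ^ nat (- m) = p powi (m + int (nat (- m)))"
    using p_pos by (simp add: power_int_add flip: power_int_of_nat)
  also have "\<dots> = 1" using assms by simp
  finally show ?thesis
    unfolding qexp_lat_def
    using qpoch_inf_split[of "p powi m" "nat (- m)"] qpoch_inf_1 by simp
qed

lemma qexp_lat_Suc: "qexp_lat p (int n + 1) = qpoch_inf p p * qbinom_coeff p 1 0 n"
proof -
  have "p powi (int n + 1) = p * p ^ n"
    by (metis power_Suc power_int_of_nat of_nat_Suc add.commute)
  then show ?thesis
    unfolding qexp_lat_def
    using qpoch_inf_split[of p n] qpoch_pos[of p n] p_less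
    by (simp add: qbinom_coeff_1_0)
qed

lemma qexp_lat_bounds: "0 \<le> qexp_lat p m" "qexp_lat p m \<le> 1"
proof -
  have "0 \<le> qexp_lat p m \<and> qexp_lat p m \<le> 1"
  proof (cases "m \<le> 0")
    case False
    then have "p powi m = p ^ nat m" by (simp add: power_int_def)
    then have "0 \<le> p powi m" "p powi m \<le> 1"
      using p_pos p_less by (simp_all add: power_le_one)
    then show ?thesis unfolding qexp_lat_def using qpoch_inf_bounds by blast
  qed (simp add: qexp_lat_nonpos)
  then show "0 \<le> qexp_lat p m" "qexp_lat p m \<le> 1" by auto
qed

text \<open>The convolution identity for the coefficients with \<open>C = 0\<close>: \<open>B\<^sup>m (p\<^sup>m;p)\<^sub>\<infinity>\<close> is, up to a shift by one and a
constant, the coefficient of \<open>1 / (B y;p)\<^sub>\<infinity>\<close>. The vanishing for \<open>m \<le> 0\<close> makes the sum finite.\<close>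

lemma qexp_lat_convolution:
  assumes B: "B \<noteq> 0"
  shows "((\<lambda>j. qbinom_coeff p A B j * (B powi (M - int j) * qexp_lat p (M - int j))) has_sum
     (if M \<le> 0 then 0 else B * qpoch_inf p p * qbinom_coeff p A 0 (nat (M - 1)))) UNIV"
proof (cases "M \<le> 0")
  case True
  then show ?thesis by (simp add: qexp_lat_nonpos)
next
  case False
  define N where "N = nat (M - 1)"
  have M: "M = int N + 1" using False by (simp add: N_def)
  show ?thesis
  proof (rule has_sum_finite_neutralI[where B = "{..N}"])
    fix j assume "j \<in> UNIV - {..N}"
    then show "qbinom_coeff p A B j * (B powi (M - int j) * qexp_lat p (M - int j)) = 0"
      by (simp add: M qexp_lat_nonpos)
  next
    have "B * qpoch_inf p p * qbinom_coeff p A 0 N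
        = (\<Sum>j\<le>N. B * qpoch_inf p p * (qbinom_coeff p A B j * qbinom_coeff p B 0 (N - j)))"
      by (simp only: qbinom_coeff_convolution[symmetric, of A 0 N B] sum_distrib_left)
    also have "\<dots> = (\<Sum>j\<le>N. qbinom_coeff p A B j * (B powi (M - int j) * qexp_lat p (M - int j)))"
    proof (intro sum.cong refl)
      fix j assume "j \<in> {..N}"
      then have e: "M - int j = int (N - j) + 1" by (simp add: M of_nat_diff)
      have "B powi (int (N - j) + 1) = B * B ^ (N - j)"
        using B by (simp add: power_int_add)
      moreover have "qbinom_coeff p B 0 (N - j) = B ^ (N - j) * qbinom_coeff p 1 0 (N - j)"
        using qbinom_coeff_scale[of B 1 0 "N - j"] by simp
      ultimately show "B * qpoch_inf p p * (qbinom_coeff p A B j * qbinom_coeff p B 0 (N - j))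
        = qbinom_coeff p A B j * (B powi (M - int j) * qexp_lat p (M - int j))"
        by (simp add: e qexp_lat_Suc)
    qed
    finally show "(if M \<le> 0 then 0 else B * qpoch_inf p p * qbinom_coeff p A 0 (nat (M - 1))) =
      (\<Sum>j\<le>N. qbinom_coeff p A B j * (B powi (M - int j) * qexp_lat p (M - int j)))"
      using False by (simp add: N_def)
  qed auto
qed

text \<open>The two \<open>q\<close>-exponentials are inverse to each other.\<close>

lemma qexp_lat_delta:
  "((\<lambda>j. qbinom_coeff p 0 1 j * qexp_lat p (M - int j)) has_sum
     (if M = 1 then qpoch_inf p p else 0)) UNIV"
proof -
  have "(if M \<le> 0 then 0 else 1 * qpoch_inf p p * qbinom_coeff p 0 0 (nat (M - 1)))
      = (if M = 1 then qpoch_inf p p else 0)"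
    by (auto simp: qbinom_coeff_diag)
  then show ?thesis using qexp_lat_convolution[of 1 0 M] by simp
qed

lemma qexp_lat_mellin:
  assumes y: "0 < y" "y < 1"
  shows "((\<lambda>m. y powi m * qexp_lat p m) has_sum (y * qpoch_inf p p / qpoch_inf y p)) UNIV"
proof -
  let ?h = "\<lambda>n. int n + 1"
  have "((\<lambda>n. y * qpoch_inf p p * qbinom_coeff p y 0 n) has_sum
      (y * qpoch_inf p p * (qpoch_inf 0 p / qpoch_inf y p))) UNIV"
    using y by (intro has_sum_cmult_right qbinomial_has_sum) auto
  moreover have "(\<lambda>n. y * qpoch_inf p p * qbinom_coeff p y 0 n) = (\<lambda>m. y powi m * qexp_lat p m) \<circ> ?h"
  proof
    fix n
    have "qbinom_coeff p y 0 n = y ^ n * qbinom_coeff p 1 0 n"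
      using qbinom_coeff_scale[of y 1 0 n] by simp
    moreover have "y powi (int n + 1) = y * y ^ n"
      using y by (simp add: power_int_add)
    ultimately show "y * qpoch_inf p p * qbinom_coeff p y 0 n = ((\<lambda>m. y powi m * qexp_lat p m) \<circ> ?h) n"
      by (simp add: qexp_lat_Suc)
  qed
  ultimately have "((\<lambda>m. y powi m * qexp_lat p m) has_sum (y * qpoch_inf p p / qpoch_inf y p)) (range ?h)"
    by (subst has_sum_reindex) (auto simp: inj_on_def qpoch_inf_0)
  moreover have "y powi m * qexp_lat p m = 0" if "m \<in> UNIV - range ?h" for m
  proof -
    have "m = ?h (nat (m - 1))" if "m > 0" using that by simp
    then have "m \<le> 0" using that by (metis DiffD2 not_less rangeI)
    then show ?thesis by (simp add: qexp_lat_nonpos)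
  qed
  ultimately show ?thesis
    using has_sum_cong_neutral[of "range ?h" UNIV "\<lambda>m. y powi m * qexp_lat p m" "\<lambda>m. y powi m * qexp_lat p m"]
    by auto
qed

lemma abs_summable_qbinom_coeff_0: "(\<lambda>i. \<bar>qbinom_coeff p 0 w i\<bar>) summable_on UNIV"
  by (rule abs_summable_qbinom_coeff) simp

lemma bessel_lat_summable: "(\<lambda>i. qbinom_coeff p 0 w i * qexp_lat p (k + int i)) summable_on UNIV"
  using qexp_lat_bounds
  by (intro summable_on_bounded_mult[OF abs_summable_qbinom_coeff_0[of w], where K = 1])
    (simp add: abs_mult mult_left_le)

lemma bessel_lat_bounded: "\<bar>bessel_lat p w k\<bar> \<le> (\<Sum>\<^sub>\<infinity>i. \<bar>qbinom_coeff p 0 w i\<bar>)"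
proof -
  have "norm (bessel_lat p w k) \<le> (\<Sum>\<^sub>\<infinity>i. \<bar>qbinom_coeff p 0 w i\<bar>)"
    unfolding bessel_lat_def
  proof (rule norm_infsum_le)
    show "((\<lambda>i. qbinom_coeff p 0 w i * qexp_lat p (k + int i)) has_sum
        (\<Sum>\<^sub>\<infinity>i. qbinom_coeff p 0 w i * qexp_lat p (k + int i))) UNIV"
      by (rule has_sum_infsum[OF bessel_lat_summable])
    show "((\<lambda>i. \<bar>qbinom_coeff p 0 w i\<bar>) has_sum (\<Sum>\<^sub>\<infinity>i. \<bar>qbinom_coeff p 0 w i\<bar>)) UNIV"
      by (rule has_sum_infsum[OF abs_summable_qbinom_coeff_0])
    show "norm (qbinom_coeff p 0 w i * qexp_lat p (k + int i)) \<le> \<bar>qbinom_coeff p 0 w i\<bar>" for i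
      using qexp_lat_bounds by (simp add: abs_mult mult_left_le)
  qed
  then show ?thesis by simp
qed

text \<open>The substitution \<open>m = k + i\<close> turns the double sum into one whose terms are dominated by a product of a
sequence in \<open>m\<close> and a sequence in \<open>i\<close>. It moves the \<open>q\<close>-exponential that is hidden in the Bessel sequence
onto the other factor; all sums of the Bessel sequence over the lattice are computed in this way.\<close>

lemma bessel_lat_pairing:
  fixes a :: "int \<Rightarrow> real"
  assumes y: "0 < y" "y < 1" and a: "\<And>k. \<bar>a k\<bar> \<le> K"
  shows "(\<Sum>\<^sub>\<infinity>k. y powi k * bessel_lat p w k * a k)
      = (\<Sum>\<^sub>\<infinity>m. y powi m * qexp_lat p m * (\<Sum>\<^sub>\<infinity>i. qbinom_coeff p 0 (w / y) i * a (m - int i)))"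
    and "(\<lambda>k. y powi k * bessel_lat p w k * a k) summable_on UNIV"
proof -
  define c where "c m i = y powi m * qexp_lat p m * (qbinom_coeff p 0 (w / y) i * a (m - int i))"
    for m i
  have K: "K \<ge> 0" using a[of 0] by linarith
  have S: "(\<lambda>(m, i). c m i) summable_on UNIV"
  proof (rule summable_on_product_bound)
    show "(\<lambda>m. y powi m * qexp_lat p m) summable_on UNIV"
      using qexp_lat_mellin[OF y] by (rule has_sum_imp_summable)
    show "(\<lambda>i. \<bar>qbinom_coeff p 0 (w / y) i\<bar> * K) summable_on UNIV"
      by (intro summable_on_cmult_left abs_summable_qbinom_coeff_0)
    show "norm (c m i) \<le> y powi m * qexp_lat p m * (\<bar>qbinom_coeff p 0 (w / y) i\<bar> * K)" for m i
    proof -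
      have "y powi m * qexp_lat p m \<ge> 0" using y qexp_lat_bounds by simp
      then have "norm (c m i) = y powi m * qexp_lat p m * (\<bar>qbinom_coeff p 0 (w / y) i\<bar> * \<bar>a (m - int i)\<bar>)"
        unfolding c_def norm_mult[of "y powi m * qexp_lat p m"]
        by (simp only: real_norm_def abs_of_nonneg abs_mult[of "qbinom_coeff p 0 (w / y) i"])
      also have "\<dots> \<le> y powi m * qexp_lat p m * (\<bar>qbinom_coeff p 0 (w / y) i\<bar> * K)"
        using a \<open>y powi m * qexp_lat p m \<ge> 0\<close> by (intro mult_left_mono) auto
      finally show ?thesis .
    qed
  qed
  have row: "(\<Sum>\<^sub>\<infinity>i. c (k + int i) i) = y powi k * bessel_lat p w k * a k" for k
  proof -
    have "c (k + int i) i = (y powi k * a k) * (qbinom_coeff p 0 w i * qexp_lat p (k + int i))" for i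
    proof -
      have "qbinom_coeff p 0 w i = y ^ i * qbinom_coeff p 0 (w / y) i"
        using qbinom_coeff_scale[of y 0 "w / y" i] y by simp
      then show ?thesis using y by (simp add: c_def power_int_add)
    qed
    then show ?thesis
      unfolding bessel_lat_def by (simp add: infsum_cmult_right')
  qed
  show "(\<Sum>\<^sub>\<infinity>k. y powi k * bessel_lat p w k * a k)
      = (\<Sum>\<^sub>\<infinity>m. y powi m * qexp_lat p m * (\<Sum>\<^sub>\<infinity>i. qbinom_coeff p 0 (w / y) i * a (m - int i)))"
    using infsum_sheared(1)[OF S, of int] unfolding row
    by (simp add: c_def infsum_cmult_right')
  show "(\<lambda>k. y powi k * bessel_lat p w k * a k) summable_on UNIV"
    using infsum_sheared(2)[OF S, of int] unfolding row .
qed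

text \<open>The generating function of the Bessel sequence. It vanishes at \<open>y = w\<close>.\<close>

lemma bessel_lat_mellin:
  assumes y: "0 < y" "y < 1"
  shows "((\<lambda>k. y powi k * bessel_lat p w k) has_sum
      (y * qpoch_inf p p / qpoch_inf y p * qpoch_inf (w / y) p)) UNIV"
proof -
  have "(\<Sum>\<^sub>\<infinity>k. y powi k * bessel_lat p w k * 1)
      = (\<Sum>\<^sub>\<infinity>m. y powi m * qexp_lat p m * (\<Sum>\<^sub>\<infinity>i. qbinom_coeff p 0 (w / y) i * 1))"
    by (rule bessel_lat_pairing(1)[OF y, where a = "\<lambda>_. 1" and K = 1]) simp
  also have "(\<Sum>\<^sub>\<infinity>i. qbinom_coeff p 0 (w / y) i * 1) = qpoch_inf (w / y) p"
    using infsumI[OF qbinomial_has_sum[of 0 "w / y"]] by (simp add: qpoch_inf_0)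
  also have "(\<Sum>\<^sub>\<infinity>m. y powi m * qexp_lat p m * qpoch_inf (w / y) p)
      = y * qpoch_inf p p / qpoch_inf y p * qpoch_inf (w / y) p"
    by (intro infsumI has_sum_cmult_left qexp_lat_mellin y)
  finally show ?thesis
    using bessel_lat_pairing(2)[OF y, where a = "\<lambda>_. 1" and K = 1 and w = w]
    by (simp add: has_sum_iff)
qed

text \<open>Convolution with the coefficients of \<open>(y;p)\<^sub>\<infinity>\<close> cancels the denominator of the generating function and leaves
the coefficients of \<open>(w/y;p)\<^sub>\<infinity>\<close>.\<close>

lemma bessel_lat_convolution:
  "(\<Sum>\<^sub>\<infinity>i. qbinom_coeff p 0 1 i * bessel_lat p w (M - int i))
     = (if M \<le> 1 then qpoch_inf p p * qbinom_coeff p 0 w (nat (1 - M)) else 0)"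
proof -
  have "(\<Sum>\<^sub>\<infinity>i. qbinom_coeff p 0 1 i * bessel_lat p w (M - int i))
      = (\<Sum>\<^sub>\<infinity>i. \<Sum>\<^sub>\<infinity>l. qbinom_coeff p 0 1 i * (qbinom_coeff p 0 w l * qexp_lat p (M - int i + int l)))"
    by (simp add: bessel_lat_def infsum_cmult_right')
  also have "\<dots> = (\<Sum>\<^sub>\<infinity>l. \<Sum>\<^sub>\<infinity>i. qbinom_coeff p 0 1 i * (qbinom_coeff p 0 w l * qexp_lat p (M - int i + int l)))"
  proof (rule infsum_swap_UNIV, rule summable_on_product_bound)
    show "norm (qbinom_coeff p 0 1 i * (qbinom_coeff p 0 w l * qexp_lat p (M - int i + int l)))
        \<le> \<bar>qbinom_coeff p 0 1 i\<bar> * \<bar>qbinom_coeff p 0 w l\<bar>" for i l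
      using qexp_lat_bounds by (simp add: abs_mult mult_left_mono mult_left_le)
  qed (rule abs_summable_qbinom_coeff_0)+
  also have "\<dots> = (\<Sum>\<^sub>\<infinity>l. qbinom_coeff p 0 w l * (if M + int l = 1 then qpoch_inf p p else 0))"
  proof (rule infsum_cong)
    fix l
    have "(\<Sum>\<^sub>\<infinity>i. qbinom_coeff p 0 1 i * (qbinom_coeff p 0 w l * qexp_lat p (M - int i + int l)))
       = (\<Sum>\<^sub>\<infinity>i. qbinom_coeff p 0 w l * (qbinom_coeff p 0 1 i * qexp_lat p ((M + int l) - int i)))"
      by (simp add: algebra_simps)
    then show "(\<Sum>\<^sub>\<infinity>i. qbinom_coeff p 0 1 i * (qbinom_coeff p 0 w l * qexp_lat p (M - int i + int l)))
       = qbinom_coeff p 0 w l * (if M + int l = 1 then qpoch_inf p p else 0)"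
      by (simp only: infsum_cmult_right' infsumI[OF qexp_lat_delta])
  qed
  also have "\<dots> = (if M \<le> 1 then qpoch_inf p p * qbinom_coeff p 0 w (nat (1 - M)) else 0)"
  proof (intro infsumI has_sum_finite_neutralI[where B = "if M \<le> 1 then {nat (1 - M)} else {}"])
    fix l assume "l \<in> UNIV - (if M \<le> 1 then {nat (1 - M)} else {})"
    then have "M + int l \<noteq> 1" by (auto split: if_splits)
    then show "qbinom_coeff p 0 w l * (if M + int l = 1 then qpoch_inf p p else 0) = 0" by simp
  qed auto
  finally show ?thesis .
qed

text \<open>With \<open>\<Phi>(y) = y (p;p)\<^sub>\<infinity> (w/y;p)\<^sub>\<infinity> / (y;p)\<^sub>\<infinity>\<close> the product \<open>\<Phi>(y) \<Phi>(w/y) = w (p;p)\<^sub>\<infinity>\<^sup>2\<close> does not depend on \<open>y\<close>, and its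
Laurent coefficients are the sums below. The proof performs the two cancellations one after the
other on coefficients, each by \<open>qexp_lat_delta\<close>.\<close>

theorem bessel_lat_orthogonality:
  assumes w: "0 < w" "w < 1"
  shows "(\<Sum>\<^sub>\<infinity>k. w powi k * bessel_lat p w (k + n) * bessel_lat p w (k + m))
     = (if n = m then w powi (1 - m) * (qpoch_inf p p)\<^sup>2 else 0)"
proof -
  \<comment> \<open>A shift by \<open>m\<close> reduces to the correlation at distance \<open>d\<close>.\<close>
  define d where "d = n - m"
  let ?P = "qpoch_inf p p"
  let ?h = "\<lambda>i. 1 - d - int i"
  have "(\<Sum>\<^sub>\<infinity>k. w powi k * bessel_lat p w k * bessel_lat p w (k + d))
      = (\<Sum>\<^sub>\<infinity>j. w powi j * qexp_lat p j * (\<Sum>\<^sub>\<infinity>i. qbinom_coeff p 0 (w / w) i * bessel_lat p w (j - int i + d)))"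
    using bessel_lat_bounded by (rule bessel_lat_pairing(1)[OF w, where a = "\<lambda>k. bessel_lat p w (k + d)"])
  also have "\<dots> = (\<Sum>\<^sub>\<infinity>j. w powi j * qexp_lat p j *
      (if j + d \<le> 1 then ?P * qbinom_coeff p 0 w (nat (1 - (j + d))) else 0))"
  proof (rule infsum_cong)
    fix j
    have "(\<Sum>\<^sub>\<infinity>i. qbinom_coeff p 0 (w / w) i * bessel_lat p w (j - int i + d))
        = (\<Sum>\<^sub>\<infinity>i. qbinom_coeff p 0 1 i * bessel_lat p w ((j + d) - int i))"
      using w by (simp add: algebra_simps)
    then show "w powi j * qexp_lat p j * (\<Sum>\<^sub>\<infinity>i. qbinom_coeff p 0 (w / w) i * bessel_lat p w (j - int i + d))
       = w powi j * qexp_lat p j *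
      (if j + d \<le> 1 then ?P * qbinom_coeff p 0 w (nat (1 - (j + d))) else 0)"
      by (simp only: bessel_lat_convolution)
  qed
  also have "\<dots> = (\<Sum>\<^sub>\<infinity>j\<in>range ?h. w powi j * qexp_lat p j *
      (if j + d \<le> 1 then ?P * qbinom_coeff p 0 w (nat (1 - (j + d))) else 0))"
  proof (rule infsum_cong_neutral)
    fix j assume "j \<in> UNIV - range ?h"
    moreover have "j = ?h (nat (1 - d - j))" if "j + d \<le> 1" using that by simp
    ultimately have "\<not> j + d \<le> 1" by (metis DiffD2 rangeI)
    then show "w powi j * qexp_lat p j *
      (if j + d \<le> 1 then ?P * qbinom_coeff p 0 w (nat (1 - (j + d))) else 0) = 0" by simp
  qed auto
  also have "\<dots> = (\<Sum>\<^sub>\<infinity>i. w powi (?h i) * qexp_lat p (?h i) * (?P * qbinom_coeff p 0 w i))"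
    by (subst infsum_reindex) (auto simp: inj_on_def o_def)
  also have "\<dots> = (\<Sum>\<^sub>\<infinity>i. w powi (1 - d) * ?P * (qbinom_coeff p 0 1 i * qexp_lat p ((1 - d) - int i)))"
  proof (rule infsum_cong)
    fix i :: nat
    have "w powi (1 - d) = w powi (?h i) * w ^ i"
      using w power_int_add[of w "?h i" "int i"] by simp
    moreover have "qbinom_coeff p 0 w i = w ^ i * qbinom_coeff p 0 1 i"
      using qbinom_coeff_scale[of w 0 1 i] by simp
    ultimately show "w powi (?h i) * qexp_lat p (?h i) * (?P * qbinom_coeff p 0 w i)
      = w powi (1 - d) * ?P * (qbinom_coeff p 0 1 i * qexp_lat p ((1 - d) - int i))" by simp
  qed
  also have "\<dots> = w powi (1 - d) * ?P * (if 1 - d = 1 then ?P else 0)"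
    by (simp only: infsum_cmult_right' infsumI[OF qexp_lat_delta])
  finally have base: "(\<Sum>\<^sub>\<infinity>k. w powi k * bessel_lat p w k * bessel_lat p w (k + d))
      = (if d = 0 then w * ?P\<^sup>2 else 0)"
    by (simp add: power2_eq_square)
  have "(\<Sum>\<^sub>\<infinity>k. w powi k * bessel_lat p w (k + n) * bessel_lat p w (k + m))
      = (\<Sum>\<^sub>\<infinity>k. w powi (- m) * (w powi (k + m) * bessel_lat p w (k + m) * bessel_lat p w (k + m + d)))"
  proof (rule infsum_cong)
    fix k
    have "w powi k = w powi (- m) * w powi (k + m)"
      using w power_int_add[of w "- m" "k + m"] by simp
    then show "w powi k * bessel_lat p w (k + n) * bessel_lat p w (k + m)
      = w powi (- m) * (w powi (k + m) * bessel_lat p w (k + m) * bessel_lat p w (k + m + d))"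
      by (simp add: d_def mult_ac)
  qed
  also have "\<dots> = w powi (- m) * (\<Sum>\<^sub>\<infinity>k. w powi (k + m) * bessel_lat p w (k + m) * bessel_lat p w (k + m + d))"
    by (rule infsum_cmult_right')
  also have "(\<Sum>\<^sub>\<infinity>k. w powi (k + m) * bessel_lat p w (k + m) * bessel_lat p w (k + m + d))
      = (if d = 0 then w * ?P\<^sup>2 else 0)"
    using infsum_int_shift(1)[of "\<lambda>k. w powi k * bessel_lat p w k * bessel_lat p w (k + d)" m] base
    by simp
  also have "w powi (- m) * (if d = 0 then w * ?P\<^sup>2 else 0) = (if n = m then w powi (1 - m) * ?P\<^sup>2 else 0)"
    using w power_int_add[of w "- m" 1] by (auto simp: d_def)
  finally show ?thesis .
qed

lemma qbinom_coeff_1_bounds: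
  assumes "0 \<le> b" "b < 1"
  shows "0 \<le> qbinom_coeff p 1 b j" "qbinom_coeff p 1 b j \<le> 1 / qpoch_inf p p"
proof -
  have P: "0 < qpoch_inf p p" using qpoch_inf_pos p_less by simp
  have "qpoch_inf p p \<le> qpoch p p j * 1"
    unfolding qpoch_inf_split[of p j]
    using p_pos p_less by (intro mult_left_mono qpoch_inf_bounds qpoch_le_1)
      (auto simp: mult_le_one power_le_one)
  then show "0 \<le> qbinom_coeff p 1 b j" "qbinom_coeff p 1 b j \<le> 1 / qpoch_inf p p"
    unfolding qbinom_coeff_1 using P qpoch_le_1[of b j] assms
    by (auto intro!: frac_le)
qed

text \<open>The generating function of \<open>b\<^sup>k \<phi>(k)\<close>, for the parameter \<open>b u\<close>, is \<open>b y (p;p)\<^sub>\<infinity> (u/y;p)\<^sub>\<infinity> / (b y;p)\<^sub>\<infinity>\<close>; multiplication by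
\<open>(b y;p)\<^sub>\<infinity> / (y;p)\<^sub>\<infinity>\<close> replaces its denominator by \<open>(y;p)\<^sub>\<infinity>\<close>.\<close>

theorem bessel_lat_lowering:
  assumes b: "0 < b" "b < 1"
  shows "(\<Sum>\<^sub>\<infinity>j. qbinom_coeff p 1 b j * (b powi (m - int j) * bessel_lat p (b * u) (m - int j)))
     = b * bessel_lat p u m"
proof -
  define c where "c j i = qbinom_coeff p 0 u i *
      (qbinom_coeff p 1 b j * (b powi (m + int i - int j) * qexp_lat p (m + int i - int j)))" for i j
  have E: "((\<lambda>j. qbinom_coeff p 1 b j * (b powi (M - int j) * qexp_lat p (M - int j))) has_sum
      (b * qexp_lat p M)) UNIV" for M
  proof -
    have "(if M \<le> 0 then 0 else b * qpoch_inf p p * qbinom_coeff p 1 0 (nat (M - 1))) = b * qexp_lat p M"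
      using qexp_lat_nonpos[of M] qexp_lat_Suc[of "nat (M - 1)"] by auto
    then show ?thesis using qexp_lat_convolution[of b 1 M] b by simp
  qed
  have nonneg: "0 \<le> qbinom_coeff p 1 b j * (b powi (M - int j) * qexp_lat p (M - int j))" for M j
    using b by (simp add: qbinom_coeff_1_bounds qexp_lat_bounds)
  have S: "(\<lambda>(i, j). c j i) summable_on UNIV"
  proof (rule summable_on_rows)
    show "((\<lambda>j. \<bar>qbinom_coeff p 0 u i\<bar> *
      (qbinom_coeff p 1 b j * (b powi (m + int i - int j) * qexp_lat p (m + int i - int j)))) has_sum
        (\<bar>qbinom_coeff p 0 u i\<bar> * (b * qexp_lat p (m + int i)))) UNIV" for i
      by (rule has_sum_cmult_right[OF E])
    show "(\<lambda>i. \<bar>qbinom_coeff p 0 u i\<bar> * (b * qexp_lat p (m + int i))) summable_on UNIV"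
    proof (rule summable_on_bounded_mult[OF abs_summable_qbinom_coeff_0[of u], where K = b])
      fix i
      show "norm (\<bar>qbinom_coeff p 0 u i\<bar> * (b * qexp_lat p (m + int i))) \<le> \<bar>qbinom_coeff p 0 u i\<bar> * b"
        using b qexp_lat_bounds by (simp add: abs_mult mult_left_mono mult_left_le)
    qed
    show "norm (c j i) \<le> \<bar>qbinom_coeff p 0 u i\<bar> *
      (qbinom_coeff p 1 b j * (b powi (m + int i - int j) * qexp_lat p (m + int i - int j)))" for i j
      unfolding c_def norm_mult[of "qbinom_coeff p 0 u i"] using nonneg[of j "m + int i"] by simp
  qed
  have "(\<Sum>\<^sub>\<infinity>j. qbinom_coeff p 1 b j * (b powi (m - int j) * bessel_lat p (b * u) (m - int j)))
      = (\<Sum>\<^sub>\<infinity>j. \<Sum>\<^sub>\<infinity>i. c j i)"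
  proof (rule infsum_cong)
    fix j
    have "c j i = qbinom_coeff p 1 b j * (b powi (m - int j) *
        (qbinom_coeff p 0 (b * u) i * qexp_lat p (m - int j + int i)))" for i
    proof -
      have e: "m + int i - int j = m - int j + int i" by simp
      have "b powi (m - int j + int i) = b powi (m - int j) * b ^ i"
        using b power_int_add[of b "m - int j" "int i"] by simp
      moreover have "qbinom_coeff p 0 (b * u) i = b ^ i * qbinom_coeff p 0 u i"
        using qbinom_coeff_scale[of b 0 u i] by simp
      ultimately show ?thesis unfolding c_def e by (simp only: mult_ac)
    qed
    then show "qbinom_coeff p 1 b j * (b powi (m - int j) * bessel_lat p (b * u) (m - int j))
        = (\<Sum>\<^sub>\<infinity>i. c j i)"
      by (simp only: bessel_lat_def infsum_cmult_right')
  qed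
  also have "\<dots> = (\<Sum>\<^sub>\<infinity>i. \<Sum>\<^sub>\<infinity>j. c j i)"
    by (rule infsum_swap_UNIV[OF S, symmetric])
  also have "\<dots> = (\<Sum>\<^sub>\<infinity>i. b * (qbinom_coeff p 0 u i * qexp_lat p (m + int i)))"
    unfolding c_def by (simp only: infsum_cmult_right' infsumI[OF E] mult.left_commute[of _ b])
  also have "\<dots> = b * bessel_lat p u m"
    by (simp add: infsum_cmult_right' bessel_lat_def)
  finally show ?thesis .
qed

end

section \<open>The power series of the Bessel function\<close>

text \<open>\<open>\<^sub>1\<phi>\<^sub>1(0; w; p, z)\<close>.\<close>

definition bessel_series :: "real \<Rightarrow> real \<Rightarrow> real \<Rightarrow> real" where
  "bessel_series p w z = (\<Sum>\<^sub>\<infinity>n. qbinom_coeff p 0 1 n / qpoch w p n * z ^ n)"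

context q_base
begin

lemma inverse_qpoch:
  assumes "w < 1"
  shows "1 / qpoch w p n = qpoch_inf (w * p ^ n) p / qpoch_inf w p"
proof -
  have "qpoch_inf (w * p ^ n) p \<noteq> 0"
    using qpoch_inf_split[of w n] qpoch_inf_pos[OF assms] by auto
  then show ?thesis
    using qpoch_inf_split[of w n] qpoch_pos[OF assms, of n] by simp
qed

lemma bessel_series_term:
  assumes "w < 1"
  shows "qbinom_coeff p 0 1 n / qpoch w p n * z ^ n
     = qbinom_coeff p 0 z n * qpoch_inf (w * p ^ n) p / qpoch_inf w p"
proof -
  have "qbinom_coeff p 0 z n = z ^ n * qbinom_coeff p 0 1 n"
    using qbinom_coeff_scale[of z 0 1 n] by simp
  moreover have "qbinom_coeff p 0 1 n / qpoch w p n * z ^ n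
      = (z ^ n * qbinom_coeff p 0 1 n) * (1 / qpoch w p n)" by simp
  ultimately show ?thesis by (simp only: inverse_qpoch[OF assms]) simp
qed

lemma bessel_series_term_bound:
  assumes w: "0 < w" "w < 1"
  shows "\<bar>qbinom_coeff p 0 1 n / qpoch w p n * z ^ n\<bar> \<le> \<bar>qbinom_coeff p 0 z n\<bar> * (1 / qpoch_inf w p)"
proof -
  have P: "qpoch_inf w p > 0" using qpoch_inf_pos w by simp
  have "0 \<le> w * p ^ n" "w * p ^ n \<le> 1"
    using w p_pos p_less mult_le_one[of w "p ^ n"] power_le_one[of p n] by simp_all
  then have "0 \<le> qpoch_inf (w * p ^ n) p" "qpoch_inf (w * p ^ n) p \<le> 1"
    by (rule qpoch_inf_bounds)+
  then have E: "0 \<le> qpoch_inf (w * p ^ n) p / qpoch_inf w p" "qpoch_inf (w * p ^ n) p / qpoch_inf w p \<le> 1 / qpoch_inf w p"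
    using P by (simp_all add: divide_right_mono)
  have "\<bar>qbinom_coeff p 0 1 n / qpoch w p n * z ^ n\<bar>
      = \<bar>qbinom_coeff p 0 z n\<bar> * (qpoch_inf (w * p ^ n) p / qpoch_inf w p)"
    unfolding bessel_series_term[OF w(2)] times_divide_eq_right[symmetric] abs_mult
    by (simp only: abs_of_nonneg[OF E(1)])
  also have "\<dots> \<le> \<bar>qbinom_coeff p 0 z n\<bar> * (1 / qpoch_inf w p)"
    by (rule mult_left_mono[OF E(2)]) simp
  finally show ?thesis .
qed

lemma bessel_series_abs_summable:
  assumes w: "0 < w" "w < 1"
  shows "(\<lambda>n. \<bar>qbinom_coeff p 0 1 n / qpoch w p n * z ^ n\<bar>) summable_on UNIV"
proof (rule summable_on_bounded_mult[OF abs_summable_qbinom_coeff_0[of z], where K = "1 / qpoch_inf w p"])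
  show "norm \<bar>qbinom_coeff p 0 1 n / qpoch w p n * z ^ n\<bar> \<le> \<bar>qbinom_coeff p 0 z n\<bar> * (1 / qpoch_inf w p)" for n
    using bessel_series_term_bound[OF w, of n z] by (simp only: real_norm_def abs_idempotent)
qed

lemma bessel_series_eq_suminf:
  assumes w: "0 < w" "w < 1"
  shows "bessel_series p w z = (\<Sum>n. qbinom_coeff p 0 1 n / qpoch w p n * z ^ n)"
    and "summable (\<lambda>n. qbinom_coeff p 0 1 n / qpoch w p n * z ^ n)"
proof -
  have "(\<lambda>n. qbinom_coeff p 0 1 n / qpoch w p n * z ^ n) summable_on UNIV"
    by (rule abs_summable_summable) (use bessel_series_abs_summable[OF w, of z] in simp)
  then have "(\<lambda>n. qbinom_coeff p 0 1 n / qpoch w p n * z ^ n) sums bessel_series p w z"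
    unfolding bessel_series_def by (intro has_sum_imp_sums has_sum_infsum)
  then show "bessel_series p w z = (\<Sum>n. qbinom_coeff p 0 1 n / qpoch w p n * z ^ n)"
    and "summable (\<lambda>n. qbinom_coeff p 0 1 n / qpoch w p n * z ^ n)"
    by (auto simp: sums_iff)
qed

lemma bessel_series_0 [simp]:
  assumes w: "0 < w" "w < 1"
  shows "bessel_series p w 0 = 1"
  unfolding bessel_series_eq_suminf(1)[OF w] powser_zero by (simp add: qbinom_coeff_0 qpoch_def)

lemma isCont_bessel_series_0:
  assumes w: "0 < w" "w < 1"
  shows "isCont (bessel_series p w) 0"
proof -
  have "isCont (\<lambda>z. \<Sum>n. qbinom_coeff p 0 1 n / qpoch w p n * z ^ n) 0"
    using bessel_series_eq_suminf(2)[OF w, of 1] by (intro isCont_powser[where K = 1]) auto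
  then show ?thesis using bessel_series_eq_suminf(1)[OF w] by presburger
qed

text \<open>Expanding \<open>(w p\<^sup>n;p)\<^sub>\<infinity>\<close> in powers of \<open>w\<close> gives a double series that is symmetric in \<open>w\<close> and \<open>z\<close>; summing it in
the other order produces \<open>(z p\<^sup>i;p)\<^sub>\<infinity>\<close> instead.\<close>

theorem bessel_series_lattice:
  assumes w: "0 < w" "w < 1"
  shows "qpoch_inf w p * bessel_series p w (p powi k) = bessel_lat p w k"
proof -
  let ?z = "p powi k"
  define c where "c n i = qbinom_coeff p 0 ?z n * qbinom_coeff p 0 w i * p ^ (n * i)" for n i
  have P: "qpoch_inf w p > 0" using qpoch_inf_pos w by simp
  have prod: "(\<Sum>\<^sub>\<infinity>i. qbinom_coeff p 0 x i * p ^ (n * i)) = qpoch_inf (x * p ^ n) p" for x n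
  proof -
    have "qbinom_coeff p 0 x i * p ^ (n * i) = qbinom_coeff p 0 (x * p ^ n) i" for i
      using qbinom_coeff_scale[of "p ^ n" 0 x i] by (simp add: mult_ac flip: power_mult)
    then show ?thesis
      using infsumI[OF qbinomial_has_sum[of 0 "x * p ^ n"]] by (simp add: qpoch_inf_0)
  qed
  have S: "(\<lambda>(n, i). c n i) summable_on UNIV"
  proof (rule summable_on_product_bound)
    show "norm (c n i) \<le> \<bar>qbinom_coeff p 0 ?z n\<bar> * \<bar>qbinom_coeff p 0 w i\<bar>" for n i
      using p_pos p_less by (simp add: c_def abs_mult mult_left_le power_le_one)
  qed (rule abs_summable_qbinom_coeff_0)+
  have "qpoch_inf w p * bessel_series p w ?z
      = (\<Sum>\<^sub>\<infinity>n. qpoch_inf w p * (qbinom_coeff p 0 1 n / qpoch w p n * ?z ^ n))"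
    unfolding bessel_series_def by (rule infsum_cmult_right'[symmetric])
  also have "\<dots> = (\<Sum>\<^sub>\<infinity>n. qbinom_coeff p 0 ?z n * qpoch_inf (w * p ^ n) p)"
    unfolding bessel_series_term[OF w(2)] using P by simp
  also have "\<dots> = (\<Sum>\<^sub>\<infinity>n. \<Sum>\<^sub>\<infinity>i. c n i)"
    unfolding c_def mult.assoc by (simp only: infsum_cmult_right' prod)
  also have "\<dots> = (\<Sum>\<^sub>\<infinity>i. \<Sum>\<^sub>\<infinity>n. c n i)"
    by (rule infsum_swap_UNIV[OF S])
  also have "\<dots> = (\<Sum>\<^sub>\<infinity>i. qbinom_coeff p 0 w i * (\<Sum>\<^sub>\<infinity>n. qbinom_coeff p 0 ?z n * p ^ (i * n)))"
    unfolding c_def by (simp only: infsum_cmult_right'[symmetric] mult_ac)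
  also have "\<dots> = (\<Sum>\<^sub>\<infinity>i. qbinom_coeff p 0 w i * qexp_lat p (k + int i))"
    using p_pos by (simp only: prod) (simp add: qexp_lat_def power_int_add)
  also have "\<dots> = bessel_lat p w k"
    by (simp add: bessel_lat_def)
  finally show ?thesis .
qed

text \<open>Termwise, the sum over \<open>j\<close> is a \<open>q\<close>-beta integral of the monomial \<open>z\<^sup>n\<close>, and it replaces the factor \<open>(u;p)\<^sub>n\<close> of the
coefficient by \<open>(b u;p)\<^sub>n\<close>. The power series also covers \<open>z = 0\<close>, which is not of the form \<open>p\<^sup>k\<close>.\<close>

theorem bessel_series_raising:
  assumes u: "0 < u" "u < 1" and b: "0 < b" "b < 1"
  shows "(\<Sum>\<^sub>\<infinity>j. qbinom_coeff p u (b * u) j * bessel_series p u (z * p ^ j))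
     = qpoch_inf (b * u) p / qpoch_inf u p * bessel_series p (b * u) z"
proof -
  define t where "t n = qbinom_coeff p 0 1 n / qpoch u p n * z ^ n" for n
  define c where "c j n = qbinom_coeff p u (b * u) j * (t n * p ^ (n * j))" for j n
  have bu: "b * u < 1" using mult_strict_mono[of b 1 u 1] b u by simp
  have P: "qpoch_inf u p > 0" "qpoch_inf (b * u) p > 0"
    using qpoch_inf_pos u bu by simp_all
  have S: "(\<lambda>(j, n). c j n) summable_on UNIV"
  proof (rule summable_on_product_bound)
    show "(\<lambda>j. \<bar>qbinom_coeff p u (b * u) j\<bar>) summable_on UNIV"
      using u by (intro abs_summable_qbinom_coeff) auto
    show "(\<lambda>n. \<bar>t n\<bar>) summable_on UNIV"
      unfolding t_def by (rule bessel_series_abs_summable[OF u])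
    show "norm (c j n) \<le> \<bar>qbinom_coeff p u (b * u) j\<bar> * \<bar>t n\<bar>" for j n
      using p_pos p_less by (simp add: c_def abs_mult mult_left_mono mult_left_le power_le_one)
  qed
  \<comment> \<open>\<open>q\<close>-binomial theorem with parameters \<open>u p\<^sup>n\<close> and \<open>b u p\<^sup>n\<close>.\<close>
  have column: "(\<Sum>\<^sub>\<infinity>j. c j n) = qpoch_inf (b * u) p / qpoch_inf u p *
      (qbinom_coeff p 0 1 n / qpoch (b * u) p n * z ^ n)" for n
  proof -
    have "qbinom_coeff p (u * p ^ n) (b * u * p ^ n) j = qbinom_coeff p u (b * u) j * p ^ (n * j)" for j
      using qbinom_coeff_scale[of "p ^ n" u "b * u" j] by (simp add: mult_ac flip: power_mult)
    moreover have "u * p ^ n \<le> u * 1"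
      using u p_pos p_less by (intro mult_left_mono power_le_one) auto
    then have "u * p ^ n < 1" using u(2) by linarith
    then have "(qbinom_coeff p (u * p ^ n) (b * u * p ^ n) has_sum
        (qpoch_inf (b * u * p ^ n) p / qpoch_inf (u * p ^ n) p)) UNIV"
      using u p_pos p_less by (intro qbinomial_has_sum) (simp add: abs_mult)
    ultimately have "(\<Sum>\<^sub>\<infinity>j. qbinom_coeff p u (b * u) j * p ^ (n * j))
        = qpoch_inf (b * u * p ^ n) p / qpoch_inf (u * p ^ n) p"
      using infsumI[of "qbinom_coeff p (u * p ^ n) (b * u * p ^ n)"] by (simp cong: infsum_cong)
    also have "\<dots> = (qpoch_inf (b * u) p / qpoch_inf u p) * (qpoch u p n / qpoch (b * u) p n)"
      using inverse_qpoch[of u n] inverse_qpoch[of "b * u" n] u bu P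
        qpoch_pos[of u n] qpoch_pos[of "b * u" n]
      by (simp add: field_simps)
    finally have *: "(\<Sum>\<^sub>\<infinity>j. qbinom_coeff p u (b * u) j * p ^ (n * j))
      = (qpoch_inf (b * u) p / qpoch_inf u p) * (qpoch u p n / qpoch (b * u) p n)" .
    have "(\<Sum>\<^sub>\<infinity>j. c j n) = t n * (\<Sum>\<^sub>\<infinity>j. qbinom_coeff p u (b * u) j * p ^ (n * j))"
      unfolding c_def by (simp only: infsum_cmult_right'[symmetric] mult_ac)
    then show ?thesis
      unfolding * t_def using qpoch_pos[of u n] u by simp
  qed
  have "(\<Sum>\<^sub>\<infinity>j. qbinom_coeff p u (b * u) j * bessel_series p u (z * p ^ j)) = (\<Sum>\<^sub>\<infinity>j. \<Sum>\<^sub>\<infinity>n. c j n)"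
  proof (rule infsum_cong)
    fix j
    have "qbinom_coeff p 0 1 n / qpoch u p n * (z * p ^ j) ^ n = t n * p ^ (n * j)" for n
      by (simp add: t_def power_mult_distrib power_mult mult.commute)
    then show "qbinom_coeff p u (b * u) j * bessel_series p u (z * p ^ j) = (\<Sum>\<^sub>\<infinity>n. c j n)"
      unfolding bessel_series_def c_def by (simp only: infsum_cmult_right')
  qed
  also have "\<dots> = (\<Sum>\<^sub>\<infinity>n. \<Sum>\<^sub>\<infinity>j. c j n)"
    by (rule infsum_swap_UNIV[OF S])
  also have "\<dots> = qpoch_inf (b * u) p / qpoch_inf u p * bessel_series p (b * u) z"
    unfolding column bessel_series_def by (rule infsum_cmult_right')
  finally show ?thesis .
qed

end

lemma q_bessel3_eq_bessel_series:
  assumes q: "0 < q" "q < 1" and \<beta>: "\<beta> > -1"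
  shows "q_bessel3 q \<beta> z = bessel_series (q\<^sup>2) (q powr (2 * \<beta> + 2)) (((1 - q) * z)\<^sup>2)"
proof -
  have p: "0 < q\<^sup>2" "q\<^sup>2 < 1" using q by (simp_all add: power_less_one_iff)
  interpret q_base "q\<^sup>2" using p by unfold_locales
  have w: "0 < q powr (2 * \<beta> + 2)" "q powr (2 * \<beta> + 2) < 1"
    using q \<beta> powr_less_mono'[of q 0 "2 * \<beta> + 2"] by simp_all
  have "q ^ (n * (n - 1)) = (q\<^sup>2) ^ (n choose 2)" for n :: nat
  proof -
    have "even (n * (n - 1))" by (cases n) auto
    then have "2 * (n choose 2) = n * (n - 1)" by (simp add: choose_two)
    then show ?thesis by (simp flip: power_mult)
  qed
  moreover have "(((1 - q) * z)\<^sup>2) ^ n = (1 - q) ^ (2 * n) * z ^ (2 * n)" for n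
    by (simp add: power_mult_distrib power_mult)
  ultimately show ?thesis
    unfolding q_bessel3_def bessel_series_eq_suminf(1)[OF w] qbinom_coeff_0_1
    by (simp add: mult_ac)
qed

section \<open>The transform kernel on the lattice\<close>

text \<open>The integer \<open>s\<close> expresses the arithmetic condition on \<open>q\<close>.\<close>

locale q_bessel_lattice =
  fixes q \<alpha> :: real and s :: int
  assumes q_pos: "0 < q" and q_less: "q < 1" and q_s: "1 - q = q powi s" and alpha: "\<alpha> > - 1 / 2"
begin

definition "p = q\<^sup>2"
definition "b = q powr (2 * \<alpha> + 1)"
definition "w = q powr (2 * \<alpha> + 2)"

definition bessel_kernel :: "real \<Rightarrow> real \<Rightarrow> real" where
  "bessel_kernel v x = bessel_series p v (((1 - q) * x)\<^sup>2)"

lemma p_bounds: "0 < p" "p < 1"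
  using q_pos q_less by (simp_all add: p_def power_less_one_iff)

sublocale q_base p
  using p_bounds by unfold_locales

lemma b_bounds: "0 < b" "b < 1"
  using q_pos q_less alpha powr_less_mono'[of q 0 "2 * \<alpha> + 1"] by (simp_all add: b_def)

lemma w_eq: "w = b * q"
  using q_pos powr_add[of q "2 * \<alpha> + 1" 1] by (simp add: w_def b_def add.assoc)

lemma w_bounds: "0 < w" "w < 1"
  using q_pos q_less b_bounds mult_strict_mono[of b 1 q 1] by (simp_all add: w_eq)

lemma w_powi: "w powi k = b powi k * q powi k"
  by (simp add: w_eq power_int_mult_distrib)

lemma q_bessel3_eq_kernel: "q_bessel3 q \<alpha> x = bessel_kernel w x"
  using q_bessel3_eq_bessel_series[of q \<alpha> x] q_pos q_less alpha by (simp add: bessel_kernel_def p_def w_def)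

lemma q_cos_eq_kernel: "q_cos q x = bessel_kernel q x"
  using q_bessel3_eq_bessel_series[of q "- 1 / 2" x] q_pos q_less
  by (simp add: q_cos_def bessel_kernel_def p_def)

lemma kernel_minus [simp]: "bessel_kernel v (- x) = bessel_kernel v x"
  by (simp add: bessel_kernel_def)

text \<open>This is where the arithmetic condition on \<open>q\<close> enters: \<open>((1 - q) q\<^sup>k)\<^sup>2\<close> is the power \<open>p\<^bsup>k+s\<^esup>\<close>.\<close>

lemma kernel_lattice:
  assumes v: "0 < v" "v < 1"
  shows "bessel_kernel v (q powi k) = bessel_lat p v (k + s) / qpoch_inf v p"
proof -
  have "((1 - q) * q powi k)\<^sup>2 = p powi (k + s)"
    using q_pos unfolding q_s p_def power2_eq_square power_int_mult_distrib
    by (simp add: power_int_add mult_ac)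
  then show ?thesis
    using bessel_series_lattice[OF v, of "k + s"] qpoch_inf_pos[OF v(2)]
    by (simp add: bessel_kernel_def field_simps)
qed

lemma kernel_0 [simp]: "0 < v \<Longrightarrow> v < 1 \<Longrightarrow> bessel_kernel v 0 = 1"
  by (simp add: bessel_kernel_def bessel_series_0)

text \<open>All functions involved are even, and scaling by powers of \<open>q\<close> preserves this half of the lattice.\<close>

definition nonneg_lattice :: "real set" where
  "nonneg_lattice = insert 0 (range (\<lambda>k::int. q powi k))"

lemma nonneg_lattice_mult:
  assumes "x \<in> nonneg_lattice"
  shows "x * q powi k \<in> nonneg_lattice"
proof (cases "x = 0")
  case False
  then obtain n where "x = q powi n" using assms by (auto simp: nonneg_lattice_def)
  then have "x * q powi k = q powi (n + k)" using q_pos by (simp add: power_int_add)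
  then show ?thesis by (simp add: nonneg_lattice_def)
qed (simp add: nonneg_lattice_def)

lemma nonneg_lattice_mult_power:
  assumes "x \<in> nonneg_lattice"
  shows "x * q ^ j \<in> nonneg_lattice"
  using nonneg_lattice_mult[OF assms, of "int j"] by simp

lemma powi_in_nonneg_lattice [simp]: "q powi k \<in> nonneg_lattice"
  by (simp add: nonneg_lattice_def)

lemma kernel_bounded:
  assumes v: "0 < v" "v < 1"
  shows "\<exists>K\<ge>0. \<forall>x\<in>nonneg_lattice. \<bar>bessel_kernel v x\<bar> \<le> K"
proof -
  \<comment> \<open>The \<open>1\<close> is for the value at 0, the other bound for the points \<open>q\<^sup>k\<close>.\<close>
  define K where "K = max 1 ((\<Sum>\<^sub>\<infinity>i. \<bar>qbinom_coeff p 0 v i\<bar>) / qpoch_inf v p)"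
  have "\<bar>bessel_kernel v x\<bar> \<le> K" if x: "x \<in> nonneg_lattice" for x
  proof (cases "x = 0")
    case False
    then obtain k where "x = q powi k" using x by (auto simp: nonneg_lattice_def)
    then have "\<bar>bessel_kernel v x\<bar> \<le> (\<Sum>\<^sub>\<infinity>i. \<bar>qbinom_coeff p 0 v i\<bar>) / qpoch_inf v p"
      using bessel_lat_bounded[of v] qpoch_inf_pos[OF v(2)]
      by (simp add: kernel_lattice[OF v] divide_right_mono)
    then show ?thesis by (simp add: K_def)
  qed (use v in \<open>simp add: K_def\<close>)
  moreover have "K \<ge> 0" by (simp add: K_def)
  ultimately show ?thesis by blast
qed

lemma kernel_tendsto_1:
  assumes v: "0 < v" "v < 1"
  shows "(\<lambda>n. bessel_kernel v (q ^ n * x)) \<longlonglongrightarrow> 1"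
proof -
  have "(\<lambda>n. ((1 - q) * (q ^ n * x))\<^sup>2) \<longlonglongrightarrow> ((1 - q) * (0 * x))\<^sup>2"
    using q_pos q_less by (intro tendsto_intros LIMSEQ_power_zero) auto
  then have "(\<lambda>n. bessel_series p v (((1 - q) * (q ^ n * x))\<^sup>2)) \<longlonglongrightarrow> bessel_series p v 0"
    by (intro isCont_tendsto_compose[OF isCont_bessel_series_0[OF v]]) simp
  then show ?thesis by (simp add: bessel_kernel_def bessel_series_0[OF v])
qed

lemma kernel_mellin:
  assumes v: "0 < v" "v < 1" and y: "0 < y" "y < 1"
  shows "((\<lambda>k. y powi k * bessel_kernel v (q powi k)) has_sum
      (y powi (1 - s) * qpoch_inf p p * qpoch_inf (v / y) p / (qpoch_inf y p * qpoch_inf v p))) UNIV"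
proof -
  let ?g = "\<lambda>k. y powi k * bessel_lat p v k"
  have "(?g has_sum (y * qpoch_inf p p / qpoch_inf y p * qpoch_inf (v / y) p)) UNIV"
    by (rule bessel_lat_mellin[OF y])
  then have "((\<lambda>k. ?g (k + s)) has_sum (y * qpoch_inf p p / qpoch_inf y p * qpoch_inf (v / y) p)) UNIV"
    using infsum_int_shift[of ?g s] by (simp add: has_sum_iff)
  then have "((\<lambda>k. (y powi (- s) / qpoch_inf v p) * ?g (k + s)) has_sum
      ((y powi (- s) / qpoch_inf v p) * (y * qpoch_inf p p / qpoch_inf y p * qpoch_inf (v / y) p))) UNIV"
    by (rule has_sum_cmult_right)
  moreover have "(y powi (- s) / qpoch_inf v p) * ?g (k + s) = y powi k * bessel_kernel v (q powi k)" for k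
    using y power_int_add[of y "- s" "k + s"] by (simp add: kernel_lattice[OF v])
  moreover have "(y powi (- s) / qpoch_inf v p) * (y * qpoch_inf p p / qpoch_inf y p * qpoch_inf (v / y) p)
     = y powi (1 - s) * qpoch_inf p p * qpoch_inf (v / y) p / (qpoch_inf y p * qpoch_inf v p)"
    using y power_int_add[of y "- s" 1] by (simp add: mult_ac)
  ultimately show ?thesis by simp
qed

lemma kernel_abs_summable:
  assumes v: "0 < v" "v < 1" and y: "0 < y" "y < 1"
  shows "(\<lambda>k. \<bar>y powi k * bessel_kernel v (q powi k)\<bar>) summable_on UNIV"
  using summable_on_iff_abs_summable_on_real[of "\<lambda>k. y powi k * bessel_kernel v (q powi k)" UNIV]
    has_sum_imp_summable[OF kernel_mellin[OF v y]] by (simp only: real_norm_def)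

lemma kernel_orthogonality:
  assumes v: "0 < v" "v < 1"
  shows "(\<Sum>\<^sub>\<infinity>k. v powi k * bessel_kernel v (q powi (k + n)) * bessel_kernel v (q powi (k + m)))
     = (if n = m then v powi (1 - s - m) * (qpoch_inf p p / qpoch_inf v p)\<^sup>2 else 0)"
proof -
  have "v powi k * bessel_kernel v (q powi (k + n)) * bessel_kernel v (q powi (k + m))
      = 1 / (qpoch_inf v p)\<^sup>2 * (v powi k * bessel_lat p v (k + (n + s)) * bessel_lat p v (k + (m + s)))" for k
    by (simp add: kernel_lattice[OF v] power2_eq_square add.assoc)
  then have "(\<Sum>\<^sub>\<infinity>k. v powi k * bessel_kernel v (q powi (k + n)) * bessel_kernel v (q powi (k + m)))
      = 1 / (qpoch_inf v p)\<^sup>2 * (\<Sum>\<^sub>\<infinity>k. v powi k * bessel_lat p v (k + (n + s)) * bessel_lat p v (k + (m + s)))"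
    by (simp only: infsum_cmult_right')
  also have "\<dots> = 1 / (qpoch_inf v p)\<^sup>2 * (if n + s = m + s then v powi (1 - (m + s)) * (qpoch_inf p p)\<^sup>2 else 0)"
    by (simp only: bessel_lat_orthogonality[OF v])
  finally show ?thesis by (simp add: power_divide algebra_simps)
qed

abbreviation "beta_coeff \<equiv> qbinom_coeff p 1 b"

lemma kernel_raising:
  "(\<Sum>\<^sub>\<infinity>j. (beta_coeff j * q ^ j) * bessel_kernel q (x * q ^ j)) = qpoch_inf w p / qpoch_inf q p * bessel_kernel w x"
proof -
  have "((1 - q) * (x * q ^ j))\<^sup>2 = ((1 - q) * x)\<^sup>2 * p ^ j" for j
    by (simp add: p_def power_mult_distrib flip: power_mult) (simp add: mult.commute)
  moreover have "beta_coeff j * q ^ j = qbinom_coeff p q (b * q) j" for j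
    using qbinom_coeff_scale[of q 1 b j] by (simp add: mult.commute)
  ultimately show ?thesis
    using bessel_series_raising[OF q_pos q_less b_bounds, of "((1 - q) * x)\<^sup>2"]
    by (simp add: bessel_kernel_def w_eq)
qed

lemma kernel_lowering:
  "(\<Sum>\<^sub>\<infinity>j. beta_coeff j * (b powi (m - int j) * bessel_kernel w (q powi (m - int j))))
     = b powi (1 - s) * qpoch_inf q p / qpoch_inf w p * bessel_kernel q (q powi m)"
proof -
  have "beta_coeff j * (b powi (m - int j) * bessel_kernel w (q powi (m - int j)))
      = b powi (- s) / qpoch_inf w p *
        (beta_coeff j * (b powi ((m + s) - int j) * bessel_lat p (b * q) ((m + s) - int j)))" for j
  proof -
    have pw: "b powi (m - int j) = b powi (- s) * b powi ((m + s) - int j)"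
      using b_bounds power_int_add[of b "- s" "(m + s) - int j"] by simp
    have e: "m - int j + s = (m + s) - int j" by simp
    show ?thesis
      unfolding kernel_lattice[OF w_bounds] pw e w_eq[symmetric] by (simp add: mult_ac)
  qed
  then have "(\<Sum>\<^sub>\<infinity>j. beta_coeff j * (b powi (m - int j) * bessel_kernel w (q powi (m - int j))))
      = b powi (- s) / qpoch_inf w p *
        (\<Sum>\<^sub>\<infinity>j. beta_coeff j * (b powi ((m + s) - int j) * bessel_lat p (b * q) ((m + s) - int j)))"
    by (simp only: infsum_cmult_right')
  also have "\<dots> = b powi (- s) / qpoch_inf w p * (b * bessel_lat p q (m + s))"
    by (simp only: bessel_lat_lowering[OF b_bounds])
  also have "\<dots> = b powi (1 - s) * qpoch_inf q p / qpoch_inf w p * bessel_kernel q (q powi m)"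
    using b_bounds power_int_add[of b "- s" 1] qpoch_inf_pos[OF q_less]
    by (simp add: kernel_lattice[OF q_pos q_less])
  finally show ?thesis .
qed

lemma beta_coeff_bounds: "0 \<le> beta_coeff j" "beta_coeff j \<le> 1 / qpoch_inf p p"
  using qbinom_coeff_1_bounds[of b j] b_bounds by auto

section \<open>Discrete Hankel, cosine and Weyl transforms\<close>

definition hankel :: "real \<Rightarrow> (int \<Rightarrow> complex) \<Rightarrow> real \<Rightarrow> complex" where
  "hankel v a x = (\<Sum>\<^sub>\<infinity>k. (v powi k * bessel_kernel v (x * q powi k)) *\<^sub>R a k)"

text \<open>The cosine transform of \<open>b\<^sup>k a(k)\<close>, that is, of a sequence that carries the weight \<open>|\<lambda>|\<^bsup>2\<alpha>+1\<^esup>\<close>; its own weight is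
\<open>q\<^sup>k b\<^sup>k = w\<^sup>k\<close>.\<close>

definition cos_transform :: "(int \<Rightarrow> complex) \<Rightarrow> real \<Rightarrow> complex" where
  "cos_transform a x = (\<Sum>\<^sub>\<infinity>k. (w powi k * bessel_kernel q (x * q powi k)) *\<^sub>R a k)"

text \<open>Absolute integrability with respect to \<open>x\<^bsup>2\<alpha>+1\<^esup> d\<^sub>q x\<close>, the natural domain of the Bessel transform.\<close>

definition weighted_summable :: "(int \<Rightarrow> complex) \<Rightarrow> bool" where
  "weighted_summable a \<longleftrightarrow> (\<lambda>k. w powi k * norm (a k)) summable_on UNIV"

lemma scaled_summable:
  assumes a: "weighted_summable a" and c: "\<And>k. \<bar>c k\<bar> \<le> K"
  shows "(\<lambda>k. (w powi k * c k) *\<^sub>R a k) summable_on UNIV"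
  using a unfolding weighted_summable_def
proof (rule summable_on_bounded_mult)
  show "norm ((w powi k * c k) *\<^sub>R a k) \<le> w powi k * norm (a k) * K" for k
  proof -
    have "(w powi k * norm (a k)) * \<bar>c k\<bar> \<le> (w powi k * norm (a k)) * K"
      using c w_bounds by (intro mult_left_mono) auto
    then show ?thesis using w_bounds by (simp add: abs_mult mult_ac)
  qed
qed

lemma hankel_bounded:
  assumes a: "weighted_summable a"
  shows "\<exists>K. \<forall>x\<in>nonneg_lattice. norm (hankel w a x) \<le> K"
proof -
  obtain K where K: "K \<ge> 0" "\<And>x. x \<in> nonneg_lattice \<Longrightarrow> \<bar>bessel_kernel w x\<bar> \<le> K"
    using kernel_bounded[OF w_bounds] by blast
  have "norm (hankel w a x) \<le> (\<Sum>\<^sub>\<infinity>k. w powi k * norm (a k)) * K" if x: "x \<in> nonneg_lattice" for x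
    unfolding hankel_def
  proof (rule norm_infsum_le)
    show "((\<lambda>k. (w powi k * bessel_kernel w (x * q powi k)) *\<^sub>R a k) has_sum
        (\<Sum>\<^sub>\<infinity>k. (w powi k * bessel_kernel w (x * q powi k)) *\<^sub>R a k)) UNIV"
      using x by (intro has_sum_infsum scaled_summable[OF a, where K = K] K nonneg_lattice_mult)
    show "((\<lambda>k. w powi k * norm (a k) * K) has_sum (\<Sum>\<^sub>\<infinity>k. w powi k * norm (a k)) * K) UNIV"
      using a unfolding weighted_summable_def by (intro has_sum_cmult_left has_sum_infsum)
    show "norm ((w powi k * bessel_kernel w (x * q powi k)) *\<^sub>R a k) \<le> w powi k * norm (a k) * K" for k
    proof -
      have "(w powi k * norm (a k)) * \<bar>bessel_kernel w (x * q powi k)\<bar> \<le> (w powi k * norm (a k)) * K"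
        using K x w_bounds by (intro mult_left_mono K nonneg_lattice_mult) auto
      then show ?thesis using w_bounds by (simp add: abs_mult mult_ac)
    qed
  qed
  then show ?thesis by blast
qed

definition hankel_const :: real where
  "hankel_const = w powi (1 - s) * (qpoch_inf p p / qpoch_inf w p)\<^sup>2"

lemma hankel_hankel:
  assumes a: "weighted_summable a"
  shows "hankel w (\<lambda>k. hankel w a (q powi k)) (q powi n) = hankel_const *\<^sub>R a n"
proof -
  obtain K where K: "K \<ge> 0" "\<And>x. x \<in> nonneg_lattice \<Longrightarrow> \<bar>bessel_kernel w x\<bar> \<le> K"
    using kernel_bounded[OF w_bounds] by blast
  define c where "c k m = (w powi k * bessel_kernel w (q powi (k + n)) * (w powi m * bessel_kernel w (q powi (k + m)))) *\<^sub>R a m"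
    for k m
  have S: "(\<lambda>(k, m). c k m) summable_on UNIV"
  proof (rule summable_on_product_bound)
    show "(\<lambda>k. w powi (- n) * \<bar>w powi (k + n) * bessel_kernel w (q powi (k + n))\<bar>) summable_on UNIV"
      using kernel_abs_summable[OF w_bounds w_bounds]
        infsum_int_shift(2)[of "\<lambda>k. \<bar>w powi k * bessel_kernel w (q powi k)\<bar>" n]
      by (intro summable_on_cmult_right) blast
    show "(\<lambda>m. w powi m * norm (a m) * K) summable_on UNIV"
      using a unfolding weighted_summable_def by (rule summable_on_cmult_left)
    fix k m
    have "w powi k = w powi (- n) * w powi (k + n)"
      using w_bounds power_int_add[of w "- n" "k + n"] by simp
    then have "norm (c k m) = w powi (- n) * \<bar>w powi (k + n) * bessel_kernel w (q powi (k + n))\<bar> *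
        (w powi m * norm (a m) * \<bar>bessel_kernel w (q powi (k + m))\<bar>)"
      using w_bounds by (simp add: c_def abs_mult)
    also have "\<dots> \<le> w powi (- n) * \<bar>w powi (k + n) * bessel_kernel w (q powi (k + n))\<bar> *
        (w powi m * norm (a m) * K)"
      using w_bounds by (intro mult_left_mono K) auto
    finally show "norm (c k m) \<le> w powi (- n) * \<bar>w powi (k + n) * bessel_kernel w (q powi (k + n))\<bar> *
        (w powi m * norm (a m) * K)" .
  qed
  have "hankel w (\<lambda>k. hankel w a (q powi k)) (q powi n) = (\<Sum>\<^sub>\<infinity>k. \<Sum>\<^sub>\<infinity>m. c k m)"
    unfolding hankel_def c_def scaleR_scaleR[symmetric] infsum_scaleR_right
    using q_pos by (simp add: power_int_add mult.commute)
  also have "\<dots> = (\<Sum>\<^sub>\<infinity>m. \<Sum>\<^sub>\<infinity>k. c k m)"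
    by (rule infsum_swap_UNIV[OF S])
  also have "\<dots> = (\<Sum>\<^sub>\<infinity>m. (if m = n then hankel_const *\<^sub>R a n else 0))"
  proof (rule infsum_cong)
    fix m
    have "(\<Sum>\<^sub>\<infinity>k. c k m) = (\<Sum>\<^sub>\<infinity>k. w powi m * (w powi k * bessel_kernel w (q powi (k + n)) * bessel_kernel w (q powi (k + m)))) *\<^sub>R a m"
      unfolding infsum_scaleR_left_complex[symmetric] c_def by (simp only: mult_ac)
    also have "(\<Sum>\<^sub>\<infinity>k. w powi m * (w powi k * bessel_kernel w (q powi (k + n)) * bessel_kernel w (q powi (k + m))))
       = w powi m * (if n = m then w powi (1 - s - m) * (qpoch_inf p p / qpoch_inf w p)\<^sup>2 else 0)"
      by (simp only: infsum_cmult_right' kernel_orthogonality[OF w_bounds])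
    also have "\<dots> = (if n = m then hankel_const else 0)"
      using w_bounds power_int_add[of w m "1 - s - m"] by (simp add: hankel_const_def)
    finally show "(\<Sum>\<^sub>\<infinity>k. c k m) = (if m = n then hankel_const *\<^sub>R a n else 0)" by auto
  qed
  also have "\<dots> = hankel_const *\<^sub>R a n"
    by (intro infsumI has_sum_finite_neutralI[where B = "{n}"]) auto
  finally show ?thesis .
qed

text \<open>At \<open>x = 0\<close> the kernel is constant and orthogonality is of no use; the value is the limit of those at \<open>q\<^sup>n\<close>.\<close>

lemma hankel_hankel_0:
  assumes a: "weighted_summable a" and g: "weighted_summable (\<lambda>k. hankel w a (q powi k))"
    and lim: "(\<lambda>n. a (int n)) \<longlonglongrightarrow> l"
  shows "hankel w (\<lambda>k. hankel w a (q powi k)) 0 = hankel_const *\<^sub>R l"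
proof -
  obtain K where K: "K \<ge> 0" "\<And>x. x \<in> nonneg_lattice \<Longrightarrow> \<bar>bessel_kernel w x\<bar> \<le> K"
    using kernel_bounded[OF w_bounds] by blast
  let ?g = "\<lambda>k. hankel w a (q powi k)"
  have "(\<lambda>n. \<Sum>\<^sub>\<infinity>k. (w powi k * bessel_kernel w (q ^ n * q powi k)) *\<^sub>R ?g k)
      \<longlonglongrightarrow> (\<Sum>\<^sub>\<infinity>k. (w powi k * 1) *\<^sub>R ?g k)"
  proof (rule infsum_int_dominated_convergence)
    show "(\<lambda>n. (w powi k * bessel_kernel w (q ^ n * q powi k)) *\<^sub>R ?g k) \<longlonglongrightarrow> (w powi k * 1) *\<^sub>R ?g k" for k
      by (intro tendsto_intros kernel_tendsto_1 w_bounds)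
    show "(\<lambda>k. w powi k * norm (?g k) * K) summable_on UNIV"
      using g unfolding weighted_summable_def by (rule summable_on_cmult_left)
    fix k n
    have "q ^ n * q powi k \<in> nonneg_lattice"
      using nonneg_lattice_mult_power[of "q powi k" n] by (simp add: mult.commute)
    then have "(w powi k * norm (?g k)) * \<bar>bessel_kernel w (q ^ n * q powi k)\<bar> \<le> (w powi k * norm (?g k)) * K"
      using w_bounds by (intro mult_left_mono K) auto
    then show "norm ((w powi k * bessel_kernel w (q ^ n * q powi k)) *\<^sub>R ?g k) \<le> w powi k * norm (?g k) * K"
      using w_bounds by (simp add: abs_mult mult_ac)
  qed
  moreover have "(\<Sum>\<^sub>\<infinity>k. (w powi k * bessel_kernel w (q ^ n * q powi k)) *\<^sub>R ?g k) = hankel_const *\<^sub>R a (int n)" for n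
    using hankel_hankel[OF a, of "int n"] by (simp add: hankel_def[of w ?g])
  moreover have "(\<Sum>\<^sub>\<infinity>k. (w powi k * 1) *\<^sub>R ?g k) = hankel w ?g 0"
    using w_bounds by (simp add: hankel_def[of w ?g])
  ultimately have "(\<lambda>n. hankel_const *\<^sub>R a (int n)) \<longlonglongrightarrow> hankel w ?g 0"
    by simp
  moreover have "(\<lambda>n. hankel_const *\<^sub>R a (int n)) \<longlonglongrightarrow> hankel_const *\<^sub>R l"
    by (intro tendsto_intros lim)
  ultimately show ?thesis by (rule LIMSEQ_unique)
qed

text \<open>As \<open>k\<close> tends to \<open>-\<infinity>\<close>, mere boundedness of \<open>a\<close> would only give \<open>w\<^sup>k |g(k)| = O(1)\<close> for the transform \<open>g\<close>. The
generating function of the kernel vanishes at \<open>w\<close>, so \<open>a\<close> can be replaced by \<open>a - l\<close>, and the Lipschitz bound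
improves the estimate to \<open>O(q\<^bsup>-k\<^esup>)\<close>.\<close>

lemma hankel_weighted_summable:
  assumes a: "weighted_summable a" and lip: "\<And>k. norm (a k - l) \<le> C * q powi k"
  shows "weighted_summable (\<lambda>k. hankel w a (q powi k))"
proof -
  let ?g = "\<lambda>k. hankel w a (q powi k)"
  obtain K where K: "K \<ge> 0" "\<And>x. x \<in> nonneg_lattice \<Longrightarrow> \<bar>bessel_kernel w x\<bar> \<le> K"
    using kernel_bounded[OF w_bounds] by blast
  obtain M where M: "\<And>x. x \<in> nonneg_lattice \<Longrightarrow> norm (hankel w a x) \<le> M"
    using hankel_bounded[OF a] by blast
  have wq: "0 < w * q" "w * q < 1"
    using w_bounds q_pos q_less mult_strict_mono[of w 1 q 1] by simp_all
  define A where "A = (\<Sum>\<^sub>\<infinity>k. \<bar>(w * q) powi k * bessel_kernel w (q powi k)\<bar>)"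
  have g2: "norm (?g k) \<le> (C * A) * (w * q) powi (- k)" for k
  proof -
    let ?\<phi> = "\<lambda>m. w powi m * bessel_kernel w (q powi (m + k))"
    have \<phi>: "(?\<phi> has_sum 0) UNIV"
    proof -
      have "((\<lambda>k. w powi k * bessel_kernel w (q powi k)) has_sum 0) UNIV"
        using kernel_mellin[OF w_bounds w_bounds] w_bounds by (simp add: qpoch_inf_1)
      then have "((\<lambda>m. w powi (m + k) * bessel_kernel w (q powi (m + k))) has_sum 0) UNIV"
        using infsum_int_shift[of "\<lambda>k. w powi k * bessel_kernel w (q powi k)" k] by (simp add: has_sum_iff)
      then have "((\<lambda>m. w powi (- k) * (w powi (m + k) * bessel_kernel w (q powi (m + k)))) has_sum (w powi (- k) * 0)) UNIV"
        by (rule has_sum_cmult_right)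
      moreover have "w powi (- k) * (w powi (m + k) * bessel_kernel w (q powi (m + k))) = ?\<phi> m" for m
        using w_bounds power_int_add[of w "- k" "m + k"] by simp
      ultimately show ?thesis by simp
    qed
    have S: "(\<lambda>m. ?\<phi> m *\<^sub>R a m) summable_on UNIV"
      using K by (intro scaled_summable[OF a, where K = K]) auto
    have "((\<lambda>m. ?\<phi> m *\<^sub>R a m + - (?\<phi> m *\<^sub>R l)) has_sum ((\<Sum>\<^sub>\<infinity>m. ?\<phi> m *\<^sub>R a m) + - (infsum ?\<phi> UNIV *\<^sub>R l))) UNIV"
    proof (intro has_sum_add has_sum_uminusI)
      show "((\<lambda>m. ?\<phi> m *\<^sub>R a m) has_sum (\<Sum>\<^sub>\<infinity>m. ?\<phi> m *\<^sub>R a m)) UNIV"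
        by (rule has_sum_infsum[OF S])
      show "((\<lambda>m. ?\<phi> m *\<^sub>R l) has_sum infsum ?\<phi> UNIV *\<^sub>R l) UNIV"
        using has_sum_infsum[OF summable_on_scaleR_left[of l ?\<phi> UNIV]] has_sum_imp_summable[OF \<phi>]
        by (simp add: infsum_scaleR_left_complex)
    qed
    moreover have "infsum ?\<phi> UNIV = 0" using \<phi> by (rule infsumI)
    moreover have "(\<Sum>\<^sub>\<infinity>m. ?\<phi> m *\<^sub>R a m) = ?g k"
      using q_pos by (simp add: hankel_def power_int_add mult.commute)
    ultimately have D: "((\<lambda>m. ?\<phi> m *\<^sub>R (a m - l)) has_sum ?g k) UNIV"
      by (simp add: scaleR_diff_right)
    have "(\<lambda>m. \<bar>(w * q) powi (m + k) * bessel_kernel w (q powi (m + k))\<bar>) summable_on UNIV"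
      using kernel_abs_summable[OF w_bounds wq]
        infsum_int_shift(2)[of "\<lambda>k. \<bar>(w * q) powi k * bessel_kernel w (q powi k)\<bar>" k] by blast
    then have "((\<lambda>m. \<bar>(w * q) powi (m + k) * bessel_kernel w (q powi (m + k))\<bar>) has_sum A) UNIV"
      using infsum_int_shift(1)[of "\<lambda>k. \<bar>(w * q) powi k * bessel_kernel w (q powi k)\<bar>" k]
      by (simp add: has_sum_iff A_def)
    then have B: "((\<lambda>m. (C * (w * q) powi (- k)) * \<bar>(w * q) powi (m + k) * bessel_kernel w (q powi (m + k))\<bar>)
        has_sum (C * (w * q) powi (- k)) * A) UNIV"
      by (rule has_sum_cmult_right)
    have "norm (?g k) \<le> (C * (w * q) powi (- k)) * A"
    proof (rule norm_infsum_le[OF D B])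
      fix m
      have XY: "(w * q) powi (- k) * (w * q) powi (m + k) = w powi m * q powi m"
        using w_bounds q_pos power_int_add[of "w * q" "- k" "m + k"]
        by (simp only: power_int_mult_distrib[symmetric]) simp
      have "\<bar>(w * q) powi (m + k) * bessel_kernel w (q powi (m + k))\<bar>
          = (w * q) powi (m + k) * \<bar>bessel_kernel w (q powi (m + k))\<bar>"
        using wq by (simp add: abs_mult)
      then have "(C * (w * q) powi (- k)) * \<bar>(w * q) powi (m + k) * bessel_kernel w (q powi (m + k))\<bar>
          = C * ((w * q) powi (- k) * (w * q) powi (m + k)) * \<bar>bessel_kernel w (q powi (m + k))\<bar>"
        by (simp only: mult.assoc)
      then have "(C * (w * q) powi (- k)) * \<bar>(w * q) powi (m + k) * bessel_kernel w (q powi (m + k))\<bar>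
          = (w powi m * \<bar>bessel_kernel w (q powi (m + k))\<bar>) * (C * q powi m)"
        unfolding XY by (simp only: mult_ac)
      moreover have "norm (?\<phi> m *\<^sub>R (a m - l)) \<le> (w powi m * \<bar>bessel_kernel w (q powi (m + k))\<bar>) * (C * q powi m)"
        unfolding norm_scaleR abs_mult using w_bounds lip by (simp add: mult_left_mono)
      ultimately show "norm (?\<phi> m *\<^sub>R (a m - l))
          \<le> (C * (w * q) powi (- k)) * \<bar>(w * q) powi (m + k) * bessel_kernel w (q powi (m + k))\<bar>"
        by (simp only:)
    qed
    then show ?thesis by (simp add: mult_ac)
  qed
  have "(\<lambda>k. norm (w powi k *\<^sub>R ?g k)) summable_on UNIV"
  proof (rule summable_on_int_two_sided[OF w_bounds])
    show "1 < 1 / q" using q_pos q_less by simp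
    show "norm (w powi k *\<^sub>R ?g k) \<le> M * w powi k" for k
      using w_bounds M[of "q powi k"] by (simp add: mult.commute mult_left_mono)
    show "norm (w powi k *\<^sub>R ?g k) \<le> C * A * (1 / q) powi k" for k
    proof -
      have "norm (w powi k *\<^sub>R ?g k) \<le> w powi k * ((C * A) * (w * q) powi (- k))"
        unfolding norm_scaleR using w_bounds g2[of k] by (simp add: mult_left_mono)
      also have "\<dots> = C * A * (1 / q) powi k"
        using w_bounds q_pos by (simp add: power_int_minus power_int_mult_distrib power_int_divide_distrib field_simps)
      finally show ?thesis .
    qed
  qed
  then show ?thesis
    unfolding weighted_summable_def using w_bounds by simp
qed

lemma riemann_liouville_cos_transform:
  assumes g: "weighted_summable g" and x: "x \<in> nonneg_lattice"
  shows "(\<Sum>\<^sub>\<infinity>j. (beta_coeff j * q ^ j) *\<^sub>R cos_transform g (x * q ^ j))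
     = (qpoch_inf w p / qpoch_inf q p) *\<^sub>R hankel w g x"
proof -
  obtain K where K: "K \<ge> 0" "\<And>x. x \<in> nonneg_lattice \<Longrightarrow> \<bar>bessel_kernel q x\<bar> \<le> K"
    using kernel_bounded[OF q_pos q_less] by blast
  have P: "0 < qpoch_inf p p" by (rule qpoch_inf_pos[OF p_bounds(2)])
  define c where "c j k = ((beta_coeff j * q ^ j) * (w powi k * bessel_kernel q (x * q powi k * q ^ j))) *\<^sub>R g k" for j k
  have S: "(\<lambda>(j, k). c j k) summable_on UNIV"
  proof (rule summable_on_product_bound)
    show "(\<lambda>j. 1 / qpoch_inf p p * q ^ j) summable_on UNIV"
      using q_pos q_less
      by (intro summable_on_cmult_right) (simp add: summable_on_UNIV_nonneg_real_iff summable_geometric)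
    show "(\<lambda>k. w powi k * norm (g k) * K) summable_on UNIV"
      using g unfolding weighted_summable_def by (rule summable_on_cmult_left)
    fix j k
    have "norm (c j k) = (beta_coeff j * q ^ j) * (w powi k * norm (g k) * \<bar>bessel_kernel q (x * q powi k * q ^ j)\<bar>)"
      using w_bounds beta_coeff_bounds[of j] q_pos by (simp add: c_def abs_mult)
    also have "\<dots> \<le> (1 / qpoch_inf p p * q ^ j) * (w powi k * norm (g k) * K)"
    proof (rule mult_mono)
      show "beta_coeff j * q ^ j \<le> 1 / qpoch_inf p p * q ^ j"
        using beta_coeff_bounds(2) q_pos by (intro mult_right_mono) auto
      show "w powi k * norm (g k) * \<bar>bessel_kernel q (x * q powi k * q ^ j)\<bar> \<le> w powi k * norm (g k) * K"
        using w_bounds x by (intro mult_left_mono K(2) nonneg_lattice_mult_power nonneg_lattice_mult) auto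
      show "0 \<le> 1 / qpoch_inf p p * q ^ j"
        using P q_pos by simp
      show "0 \<le> w powi k * norm (g k) * \<bar>bessel_kernel q (x * q powi k * q ^ j)\<bar>"
        using w_bounds by simp
    qed
    finally show "norm (c j k) \<le> (1 / qpoch_inf p p * q ^ j) * (w powi k * norm (g k) * K)" .
  qed
  have "(\<Sum>\<^sub>\<infinity>j. (beta_coeff j * q ^ j) *\<^sub>R cos_transform g (x * q ^ j)) = (\<Sum>\<^sub>\<infinity>j. \<Sum>\<^sub>\<infinity>k. c j k)"
    unfolding cos_transform_def c_def scaleR_scaleR[symmetric] infsum_scaleR_right
    by (simp add: mult_ac)
  also have "\<dots> = (\<Sum>\<^sub>\<infinity>k. \<Sum>\<^sub>\<infinity>j. c j k)"
    by (rule infsum_swap_UNIV[OF S])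
  also have "\<dots> = (\<Sum>\<^sub>\<infinity>k. (qpoch_inf w p / qpoch_inf q p) *\<^sub>R (w powi k * bessel_kernel w (x * q powi k)) *\<^sub>R g k)"
  proof (rule infsum_cong)
    fix k
    have "(\<Sum>\<^sub>\<infinity>j. c j k) = (\<Sum>\<^sub>\<infinity>j. w powi k * ((beta_coeff j * q ^ j) * bessel_kernel q (x * q powi k * q ^ j))) *\<^sub>R g k"
      unfolding infsum_scaleR_left_complex[symmetric] c_def by (simp only: mult_ac)
    then show "(\<Sum>\<^sub>\<infinity>j. c j k) = (qpoch_inf w p / qpoch_inf q p) *\<^sub>R (w powi k * bessel_kernel w (x * q powi k)) *\<^sub>R g k"
      by (simp only: infsum_cmult_right' kernel_raising) (simp add: mult_ac)
  qed
  also have "\<dots> = (qpoch_inf w p / qpoch_inf q p) *\<^sub>R hankel w g x"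
    unfolding hankel_def by (rule infsum_scaleR_right)
  finally show ?thesis .
qed

definition weyl_sum :: "(int \<Rightarrow> complex) \<Rightarrow> int \<Rightarrow> complex" where
  "weyl_sum a n = (\<Sum>\<^sub>\<infinity>j. (beta_coeff j * b powi (n - int j)) *\<^sub>R a (n - int j))"

text \<open>The Weyl transform is adjoint to the Riemann-Liouville transform; the adjoint acts on the cosine kernel.\<close>

lemma hankel_q_weyl_sum:
  assumes a: "weighted_summable a"
  shows "hankel q (weyl_sum a) (q powi l) = (qpoch_inf w p / qpoch_inf q p) *\<^sub>R hankel w a (q powi l)"
proof -
  obtain K where K: "K \<ge> 0" "\<And>x. x \<in> nonneg_lattice \<Longrightarrow> \<bar>bessel_kernel q x\<bar> \<le> K"
    using kernel_bounded[OF q_pos q_less] by blast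
  have P: "0 < qpoch_inf p p" by (rule qpoch_inf_pos[OF p_bounds(2)])
  define c where "c m j = (w powi m * ((beta_coeff j * q ^ j) * bessel_kernel q (q powi l * q powi m * q ^ j))) *\<^sub>R a m" for m j
  have S: "(\<lambda>(m, j). c m j) summable_on UNIV"
  proof (rule summable_on_product_bound)
    show "(\<lambda>j. 1 / qpoch_inf p p * q ^ j * K) summable_on UNIV"
      using q_pos q_less
      by (intro summable_on_cmult_right summable_on_cmult_left) (simp add: summable_on_UNIV_nonneg_real_iff summable_geometric)
    show "(\<lambda>m. w powi m * norm (a m)) summable_on UNIV"
      using a unfolding weighted_summable_def .
    fix m j
    have "norm (c m j) = (w powi m * norm (a m)) * (beta_coeff j * q ^ j * \<bar>bessel_kernel q (q powi l * q powi m * q ^ j)\<bar>)"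
      using w_bounds beta_coeff_bounds[of j] q_pos by (simp add: c_def abs_mult)
    also have "\<dots> \<le> (w powi m * norm (a m)) * (1 / qpoch_inf p p * q ^ j * K)"
    proof (rule mult_left_mono, rule mult_mono)
      show "beta_coeff j * q ^ j \<le> 1 / qpoch_inf p p * q ^ j"
        using beta_coeff_bounds(2) q_pos by (intro mult_right_mono) auto
      show "\<bar>bessel_kernel q (q powi l * q powi m * q ^ j)\<bar> \<le> K"
        by (intro K(2) nonneg_lattice_mult_power nonneg_lattice_mult) simp
      show "0 \<le> 1 / qpoch_inf p p * q ^ j"
        using P q_pos by simp
      show "0 \<le> w powi m * norm (a m)"
        using w_bounds by simp
    qed simp
    finally show "norm (c m j) \<le> (w powi m * norm (a m)) * (1 / qpoch_inf p p * q ^ j * K)" .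
  qed
  have "hankel q (weyl_sum a) (q powi l) = (\<Sum>\<^sub>\<infinity>k. \<Sum>\<^sub>\<infinity>j. c (k + - int j) j)"
    unfolding hankel_def weyl_sum_def infsum_scaleR_right[symmetric]
  proof (intro infsum_cong)
    fix k and j :: nat
    have "q powi k = q powi (k - int j) * q ^ j"
      using q_pos power_int_add[of q "k - int j" "int j"] by simp
    then show "(q powi k * bessel_kernel q (q powi l * q powi k)) *\<^sub>R (beta_coeff j * b powi (k - int j)) *\<^sub>R a (k - int j)
        = c (k + - int j) j"
      by (simp add: c_def w_powi mult_ac)
  qed
  also have "\<dots> = (\<Sum>\<^sub>\<infinity>m. \<Sum>\<^sub>\<infinity>j. c m j)"
    by (rule infsum_sheared(1)[OF S])
  also have "\<dots> = (\<Sum>\<^sub>\<infinity>m. (qpoch_inf w p / qpoch_inf q p) *\<^sub>R (w powi m * bessel_kernel w (q powi l * q powi m)) *\<^sub>R a m)"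
    unfolding c_def infsum_scaleR_left_complex infsum_cmult_right' kernel_raising
    by (simp add: mult_ac)
  also have "\<dots> = (qpoch_inf w p / qpoch_inf q p) *\<^sub>R hankel w a (q powi l)"
    unfolding hankel_def by (rule infsum_scaleR_right)
  finally show ?thesis .
qed

definition weyl_const :: real where
  "weyl_const = b powi (1 - s) * qpoch_inf q p / qpoch_inf w p"

lemma weyl_sum_hankel:
  assumes g: "weighted_summable g"
  shows "weyl_sum (\<lambda>m. hankel w (\<lambda>k. b powi k *\<^sub>R g k) (q powi m)) n
     = weyl_const *\<^sub>R cos_transform g (q powi n)"
proof -
  define A where "A = (\<Sum>\<^sub>\<infinity>i. \<bar>b powi i * bessel_kernel w (q powi i)\<bar>)"
  let ?h = "\<lambda>i. \<bar>b powi i * bessel_kernel w (q powi i)\<bar>"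
  have h: "?h summable_on UNIV" by (rule kernel_abs_summable[OF w_bounds b_bounds])
  define c where "c k j = (w powi k * (beta_coeff j * (b powi (n + k - int j) * bessel_kernel w (q powi (n + k - int j))))) *\<^sub>R g k"
    for k and j :: nat
  have row: "((\<lambda>j. ?h (m - int j)) has_sum infsum ?h (range (\<lambda>j. m - int j))) UNIV" for m
  proof -
    have "?h summable_on range (\<lambda>j. m - int j)"
      using h by (rule summable_on_subset) simp
    then have "(?h has_sum infsum ?h (range (\<lambda>j. m - int j))) (range (\<lambda>j. m - int j))"
      by (rule has_sum_infsum)
    then show ?thesis by (subst (asm) has_sum_reindex) (auto simp: inj_on_def o_def)
  qed
  \<comment> \<open>Bounding every half-line sum by the sum over all of \<open>\<int>\<close> makes the bound uniform in \<open>k\<close>.\<close>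
  have row_le: "infsum ?h (range (\<lambda>j. m - int j)) \<le> A" for m
    unfolding A_def using h by (intro infsum_mono2 summable_on_subset[OF h]) auto
  have S: "(\<lambda>(k, j). c k j) summable_on UNIV"
  proof (rule summable_on_rows)
    show "((\<lambda>j. (w powi k * norm (g k) * (1 / qpoch_inf p p)) * ?h (n + k - int j)) has_sum
       ((w powi k * norm (g k) * (1 / qpoch_inf p p)) * infsum ?h (range (\<lambda>j. n + k - int j)))) UNIV" for k
      by (rule has_sum_cmult_right[OF row])
    have pos: "1 / qpoch_inf p p \<ge> 0" using beta_coeff_bounds[of 0] by linarith
    show "(\<lambda>k. (w powi k * norm (g k) * (1 / qpoch_inf p p)) * infsum ?h (range (\<lambda>j. n + k - int j))) summable_on UNIV"
      using g unfolding weighted_summable_def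
    proof (rule summable_on_bounded_mult)
      fix k
      have nn: "0 \<le> w powi k * norm (g k) * (1 / qpoch_inf p p)"
        using pos w_bounds by (intro mult_nonneg_nonneg) auto
      have nn': "0 \<le> infsum ?h (range (\<lambda>j. n + k - int j))"
        by (rule infsum_nonneg) simp
      have "norm ((w powi k * norm (g k) * (1 / qpoch_inf p p)) * infsum ?h (range (\<lambda>j. n + k - int j)))
        = (w powi k * norm (g k) * (1 / qpoch_inf p p)) * infsum ?h (range (\<lambda>j. n + k - int j))"
        using mult_nonneg_nonneg[OF nn nn'] by (simp only: real_norm_def abs_of_nonneg)
      also have "\<dots> \<le> (w powi k * norm (g k) * (1 / qpoch_inf p p)) * A"
        using nn row_le by (rule mult_left_mono[rotated])
      finally show "norm ((w powi k * norm (g k) * (1 / qpoch_inf p p)) * infsum ?h (range (\<lambda>j. n + k - int j)))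
        \<le> w powi k * norm (g k) * (1 / qpoch_inf p p * A)"
        by (simp only: mult.assoc)
    qed
    fix k and j :: nat
    have "norm (c k j) = (w powi k * norm (g k) * beta_coeff j) * ?h (n + k - int j)"
      using w_bounds beta_coeff_bounds[of j] by (simp add: c_def abs_mult)
    also have "\<dots> \<le> (w powi k * norm (g k) * (1 / qpoch_inf p p)) * ?h (n + k - int j)"
      using w_bounds beta_coeff_bounds[of j] by (intro mult_right_mono mult_left_mono) auto
    finally show "norm (c k j) \<le> (w powi k * norm (g k) * (1 / qpoch_inf p p)) * ?h (n + k - int j)" .
  qed
  have "weyl_sum (\<lambda>m. hankel w (\<lambda>k. b powi k *\<^sub>R g k) (q powi m)) n = (\<Sum>\<^sub>\<infinity>j. \<Sum>\<^sub>\<infinity>k. c k j)"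
    unfolding weyl_sum_def hankel_def infsum_scaleR_right[symmetric]
  proof (intro infsum_cong)
    fix k and j :: nat
    have e: "n + k - int j = (n - int j) + k" by simp
    have eq: "q powi (n - int j) * q powi k = q powi (n + k - int j)"
      and eb: "b powi (n - int j) * b powi k = b powi (n + k - int j)"
      unfolding e using q_pos b_bounds by (simp_all add: power_int_add)
    then show "(beta_coeff j * b powi (n - int j)) *\<^sub>R (w powi k * bessel_kernel w (q powi (n - int j) * q powi k)) *\<^sub>R b powi k *\<^sub>R g k
       = c k j"
      unfolding c_def scaleR_scaleR eq eb[symmetric] by (simp only: mult_ac)
  qed
  also have "\<dots> = (\<Sum>\<^sub>\<infinity>k. \<Sum>\<^sub>\<infinity>j. c k j)"
    by (rule infsum_swap_UNIV[OF S, symmetric])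
  also have "\<dots> = (\<Sum>\<^sub>\<infinity>k. weyl_const *\<^sub>R (w powi k * bessel_kernel q (q powi n * q powi k)) *\<^sub>R g k)"
    unfolding c_def infsum_scaleR_left_complex infsum_cmult_right' kernel_lowering weyl_const_def
    using q_pos by (simp add: power_int_add mult_ac)
  also have "\<dots> = weyl_const *\<^sub>R cos_transform g (q powi n)"
    unfolding cos_transform_def by (rule infsum_scaleR_right)
  finally show ?thesis .
qed

text \<open>The Weyl transform at 0 is an integral over the whole lattice. The value of the generating function of the
kernel at \<open>b\<close> plays the role that \<open>kernel_lowering\<close> has at the other points.\<close>

lemma weyl_integral_hankel:
  assumes g: "weighted_summable g"
  shows "(\<Sum>\<^sub>\<infinity>m. b powi m *\<^sub>R hankel w (\<lambda>k. b powi k *\<^sub>R g k) (q powi m))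
     = (qpoch_inf p p / qpoch_inf b p * weyl_const) *\<^sub>R cos_transform g 0"
proof -
  let ?h = "\<lambda>i. \<bar>b powi i * bessel_kernel w (q powi i)\<bar>"
  define c where "c k m = (w powi k * (b powi (m + k) * bessel_kernel w (q powi (m + k)))) *\<^sub>R g k" for k m
  have S: "(\<lambda>(k, m). c k m) summable_on UNIV"
  proof (rule summable_on_rows)
    show "((\<lambda>m. (w powi k * norm (g k)) * ?h (m + k)) has_sum (w powi k * norm (g k)) * infsum ?h UNIV) UNIV" for k
    proof (rule has_sum_cmult_right)
      show "((\<lambda>m. ?h (m + k)) has_sum infsum ?h UNIV) UNIV"
        using infsum_int_shift[of ?h k] kernel_abs_summable[OF w_bounds b_bounds] by (simp add: has_sum_iff)
    qed
    show "(\<lambda>k. (w powi k * norm (g k)) * infsum ?h UNIV) summable_on UNIV"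
      using g unfolding weighted_summable_def by (rule summable_on_cmult_left)
    show "norm (c k m) \<le> (w powi k * norm (g k)) * ?h (m + k)" for k m
      using w_bounds by (simp add: c_def abs_mult)
  qed
  have mellin: "(\<Sum>\<^sub>\<infinity>m. b powi (m + k) * bessel_kernel w (q powi (m + k)))
      = qpoch_inf p p / qpoch_inf b p * weyl_const" for k
  proof -
    have "w / b = q" using b_bounds by (simp add: w_eq)
    then show ?thesis
      using infsum_int_shift(1)[of "\<lambda>k. b powi k * bessel_kernel w (q powi k)" k]
        infsumI[OF kernel_mellin[OF w_bounds b_bounds]] by (simp add: weyl_const_def)
  qed
  have "(\<Sum>\<^sub>\<infinity>m. b powi m *\<^sub>R hankel w (\<lambda>k. b powi k *\<^sub>R g k) (q powi m)) = (\<Sum>\<^sub>\<infinity>m. \<Sum>\<^sub>\<infinity>k. c k m)"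
    unfolding hankel_def infsum_scaleR_right[symmetric] c_def scaleR_scaleR
    using q_pos b_bounds by (simp add: power_int_add mult_ac)
  also have "\<dots> = (\<Sum>\<^sub>\<infinity>k. \<Sum>\<^sub>\<infinity>m. c k m)"
    by (rule infsum_swap_UNIV[OF S, symmetric])
  also have "\<dots> = (\<Sum>\<^sub>\<infinity>k. (qpoch_inf p p / qpoch_inf b p * weyl_const) *\<^sub>R (w powi k * bessel_kernel q (0 * q powi k)) *\<^sub>R g k)"
    unfolding c_def infsum_scaleR_left_complex infsum_cmult_right' mellin
    using q_pos q_less by (simp add: mult_ac)
  also have "\<dots> = (qpoch_inf p p / qpoch_inf b p * weyl_const) *\<^sub>R cos_transform g 0"
    unfolding cos_transform_def by (rule infsum_scaleR_right)
  finally show ?thesis .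
qed

section \<open>The transforms in terms of lattice sums\<close>

lemma powi_powr_b: "(q powi k) powr (2 * \<alpha> + 1) = b powi k"
  using q_pos by (simp add: powi_powr b_def)

lemma powi_powr_weyl: "q powi k * (q powi k) powr (2 * \<alpha>) = b powi k"
proof -
  have "q powi k > 0" using q_pos by simp
  then have "(q powi k) powr (2 * \<alpha> + 1) = (q powi k) powr (2 * \<alpha>) * q powi k"
    by (simp add: powr_add)
  then show ?thesis by (simp add: powi_powr_b)
qed

lemma q_bessel_fourier_eq_hankel:
  "q_bessel_fourier q \<alpha> f x = (q_c q \<alpha> * (1 - q)) *\<^sub>R hankel w (\<lambda>k. f (q powi k)) x"
  unfolding q_bessel_fourier_def jackson_inf_def hankel_def q_bessel3_eq_kernel powi_powr_b w_powi
  by (simp add: mult_ac)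

lemma q_fourier_cos_eq_hankel:
  "q_fourier_cos q f x = (q_c q (- 1 / 2) * (1 - q)) *\<^sub>R hankel q (\<lambda>k. f (q powi k)) x"
  unfolding q_fourier_cos_def jackson_inf_def hankel_def
  by (simp add: q_cos_eq_kernel)

lemma hankel_q_weight: "hankel q (\<lambda>k. b powi k *\<^sub>R g k) x = cos_transform g x"
  unfolding hankel_def cos_transform_def by (simp add: w_powi mult_ac)

lemma hankel_scaleR: "hankel v (\<lambda>k. c *\<^sub>R a k) x = c *\<^sub>R hankel v a x"
  unfolding hankel_def infsum_scaleR_right[symmetric] by (simp add: mult_ac)

lemma weyl_sum_scaleR: "weyl_sum (\<lambda>k. c *\<^sub>R a k) n = c *\<^sub>R weyl_sum a n"
  unfolding weyl_sum_def infsum_scaleR_right[symmetric] by (simp add: mult_ac)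

abbreviation "kernel_ratio \<equiv> qpoch_inf p p / qpoch_inf b p"

text \<open>The kernels of both fractional integrals, at \<open>t = q\<^sup>j\<close> and at \<open>x / t = q\<^sup>j\<close> respectively.\<close>

lemma beta_kernel: "qpoch_inf (p * p ^ j) p / qpoch_inf (b * p ^ j) p = kernel_ratio * beta_coeff j"
proof -
  have "qpoch_inf (b * p ^ j) p \<noteq> 0" "qpoch b p j \<noteq> 0" "qpoch p p j \<noteq> 0"
    using qpoch_inf_pos[OF b_bounds(2)] qpoch_inf_split[of b j]
      qpoch_pos[OF p_bounds(2), of j] by auto
  then show ?thesis
    unfolding qpoch_inf_split[of b j] qpoch_inf_split[of p j]
      qbinom_coeff_1 by simp
qed

definition rl_const :: real where
  "rl_const = (1 + q) * q_Gamma (q\<^sup>2) (\<alpha> + 1) / (q_Gamma (q\<^sup>2) (1 / 2) * q_Gamma (q\<^sup>2) (\<alpha> + 1 / 2))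
     * (1 - q) * kernel_ratio"

lemma q_riemann_liouville_eq_sum:
  "q_riemann_liouville q \<alpha> f x = rl_const *\<^sub>R (\<Sum>\<^sub>\<infinity>j. (beta_coeff j * q ^ j) *\<^sub>R f (x * q ^ j))"
proof -
  have "(\<Sum>\<^sub>\<infinity>n. q ^ n *\<^sub>R (qpoch_inf ((1 * q ^ n)\<^sup>2 * q\<^sup>2) (q\<^sup>2) /
        qpoch_inf ((1 * q ^ n)\<^sup>2 * q powr (2 * \<alpha> + 1)) (q\<^sup>2)) *\<^sub>R f (x * (1 * q ^ n)))
      = (\<Sum>\<^sub>\<infinity>j. kernel_ratio *\<^sub>R (beta_coeff j * q ^ j) *\<^sub>R f (x * q ^ j))"
  proof (rule infsum_cong)
    fix n
    have pn: "(q ^ n)\<^sup>2 = p ^ n" unfolding p_def by (simp add: mult.commute flip: power_mult)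
    have "qpoch_inf ((1 * q ^ n)\<^sup>2 * q\<^sup>2) (q\<^sup>2) / qpoch_inf ((1 * q ^ n)\<^sup>2 * q powr (2 * \<alpha> + 1)) (q\<^sup>2)
        = kernel_ratio * beta_coeff n"
      using beta_kernel[of n] unfolding mult_1_left pn by (simp add: p_def b_def mult.commute)
    then show "q ^ n *\<^sub>R (qpoch_inf ((1 * q ^ n)\<^sup>2 * q\<^sup>2) (q\<^sup>2) /
        qpoch_inf ((1 * q ^ n)\<^sup>2 * q powr (2 * \<alpha> + 1)) (q\<^sup>2)) *\<^sub>R f (x * (1 * q ^ n))
      = kernel_ratio *\<^sub>R (beta_coeff n * q ^ n) *\<^sub>R f (x * q ^ n)"
      by (simp only: mult_1_left scaleR_scaleR mult_ac)
  qed
  also have "\<dots> = kernel_ratio *\<^sub>R (\<Sum>\<^sub>\<infinity>j. (beta_coeff j * q ^ j) *\<^sub>R f (x * q ^ j))"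
    by (rule infsum_scaleR_right)
  finally show ?thesis
    unfolding q_riemann_liouville_def jackson_def rl_const_def by simp
qed

definition weyl_factor :: real where
  "weyl_factor = q * (1 + inverse q) powr (- \<alpha> + 1 / 2) / q_Gamma (q\<^sup>2) (\<alpha> + 1 / 2) * (1 - q)"

lemma lattice_quotient: "(q powi n)\<^sup>2 / (q powi k)\<^sup>2 = p powi (n - k)"
  using q_pos unfolding p_def power2_eq_square power_int_mult_distrib
  by (simp add: power_int_diff)

lemma q_weyl_lattice:
  "q_weyl q \<alpha> f (q powi n) = (weyl_factor * kernel_ratio) *\<^sub>R weyl_sum (\<lambda>k. f (q powi k)) n"
proof -
  let ?K = "\<lambda>t. qpoch_inf (q\<^sup>2 * (q powi n)\<^sup>2 / t\<^sup>2) (q\<^sup>2) /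
      qpoch_inf (q powr (2 * \<alpha> + 1) * (q powi n)\<^sup>2 / t\<^sup>2) (q\<^sup>2) * t powr (2 * \<alpha>)"
  have num: "qpoch_inf (q\<^sup>2 * (q powi n)\<^sup>2 / (q powi k)\<^sup>2) (q\<^sup>2) = qexp_lat p (n - k + 1)" for k
    using p_bounds unfolding times_divide_eq_right[symmetric] lattice_quotient
    by (simp add: qexp_lat_def power_int_add p_def mult.commute)
  have zero: "?K (q powi k) = 0" if "k > n" for k
    unfolding num using that by (simp add: qexp_lat_nonpos)
  \<comment> \<open>At the points \<open>t = q\<^bsup>n+1+i\<^esup>\<close> of the subtracted integral the numerator of the kernel vanishes.\<close>
  have tail: "jackson q (q * \<bar>q powi n\<bar>) (\<lambda>t. ?K t *\<^sub>R f t) = 0"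
  proof -
    have "q * \<bar>q powi n\<bar> * q ^ i = q powi (n + 1 + int i)" for i
      using q_pos by (simp add: power_int_add)
    then have K0: "?K (q * \<bar>q powi n\<bar> * q ^ i) = 0" for i
      using zero[of "n + 1 + int i"] by simp
    show ?thesis unfolding jackson_def K0 by simp
  qed
  have "(\<Sum>\<^sub>\<infinity>k. q powi k *\<^sub>R ?K (q powi k) *\<^sub>R f (q powi k))
      = (\<Sum>\<^sub>\<infinity>k\<in>range (\<lambda>j. n - int j). q powi k *\<^sub>R ?K (q powi k) *\<^sub>R f (q powi k))"
  proof (rule infsum_cong_neutral)
    fix k assume "k \<in> UNIV - range (\<lambda>j. n - int j)"
    moreover have "k = n - int (nat (n - k))" if "k \<le> n" using that by simp
    ultimately have "k > n" by (metis DiffD2 not_less rangeI)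
    then show "q powi k *\<^sub>R ?K (q powi k) *\<^sub>R f (q powi k) = 0" by (simp only: zero) simp
  qed auto
  also have "\<dots> = (\<Sum>\<^sub>\<infinity>j. q powi (n - int j) *\<^sub>R ?K (q powi (n - int j)) *\<^sub>R f (q powi (n - int j)))"
    by (subst infsum_reindex) (auto simp: inj_on_def o_def)
  also have "\<dots> = (\<Sum>\<^sub>\<infinity>j. kernel_ratio *\<^sub>R (beta_coeff j * b powi (n - int j)) *\<^sub>R f (q powi (n - int j)))"
  proof (rule infsum_cong)
    fix j :: nat
    have A: "q\<^sup>2 * (q powi n)\<^sup>2 / (q powi (n - int j))\<^sup>2 = p * p ^ j"
      and B: "q powr (2 * \<alpha> + 1) * (q powi n)\<^sup>2 / (q powi (n - int j))\<^sup>2 = b * p ^ j"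
      unfolding times_divide_eq_right[symmetric] lattice_quotient by (simp_all add: p_def b_def)
    have "q powi (n - int j) *\<^sub>R ?K (q powi (n - int j)) *\<^sub>R f (q powi (n - int j))
       = ((qpoch_inf (p * p ^ j) p / qpoch_inf (b * p ^ j) p) *
          (q powi (n - int j) * (q powi (n - int j)) powr (2 * \<alpha>))) *\<^sub>R f (q powi (n - int j))"
      unfolding A B by (simp add: p_def mult_ac)
    then show "q powi (n - int j) *\<^sub>R ?K (q powi (n - int j)) *\<^sub>R f (q powi (n - int j))
       = kernel_ratio *\<^sub>R (beta_coeff j * b powi (n - int j)) *\<^sub>R f (q powi (n - int j))"
      by (simp only: beta_kernel powi_powr_weyl scaleR_scaleR mult.assoc)
  qed
  also have "\<dots> = kernel_ratio *\<^sub>R weyl_sum (\<lambda>k. f (q powi k)) n"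
    unfolding weyl_sum_def by (rule infsum_scaleR_right)
  finally have main: "jackson_inf q (\<lambda>t. ?K t *\<^sub>R f t) = ((1 - q) * kernel_ratio) *\<^sub>R weyl_sum (\<lambda>k. f (q powi k)) n"
    unfolding jackson_inf_def by simp
  show ?thesis
    unfolding q_weyl_def jackson_tail_def tail main weyl_factor_def by simp
qed

lemma q_weyl_0: "q_weyl q \<alpha> f 0 = weyl_factor *\<^sub>R (\<Sum>\<^sub>\<infinity>m. b powi m *\<^sub>R f (q powi m))"
proof -
  have "qpoch_inf 0 (q\<^sup>2) = 1"
    using qpoch_inf_0 by (simp add: p_def)
  then show ?thesis
    unfolding q_weyl_def jackson_tail_def jackson_def jackson_inf_def weyl_factor_def
    by (simp add: powi_powr_weyl)
qed

lemma q_riemann_liouville_minus: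
  assumes "\<And>y. f (- y) = f y"
  shows "q_riemann_liouville q \<alpha> f (- x) = q_riemann_liouville q \<alpha> f x"
  unfolding q_riemann_liouville_eq_sum using assms by simp

lemma q_K1_minus: "q_K1 q \<alpha> f (- x) = q_K1 q \<alpha> f x"
  unfolding q_K1_def q_fourier_cos_inv_def q_fourier_cos_eq_hankel hankel_def by simp

lemma q_weyl_minus: "q_weyl q \<alpha> f (- x) = q_weyl q \<alpha> f x"
  unfolding q_weyl_def by simp

section \<open>Normalising constants\<close>

abbreviation "ln_q \<equiv> ln q"
abbreviation "ln_1mq \<equiv> ln (1 - q)"
abbreviation "ln_1pq \<equiv> ln (1 + q)"

lemma pow_p: "p powr y = q powr (2 * y)"
  using q_pos powr_powr[of q 2 y] by (simp add: p_def)

lemma one_minus_p_powr: "(1 - q\<^sup>2) powr y = exp (y * (ln_1mq + ln_1pq))"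
proof -
  have "1 - q\<^sup>2 = (1 - q) * (1 + q)" by (simp add: power2_eq_square algebra_simps)
  then show ?thesis using q_pos q_less by (simp add: powr_def ln_mult)
qed

lemma one_plus_inverse_q_powr: "(1 + inverse q) powr y = exp (y * (ln_1pq - ln_q))"
proof -
  have "1 + inverse q = (1 + q) / q" using q_pos by (simp add: field_simps)
  then show ?thesis using q_pos by (simp add: powr_def ln_div)
qed

text \<open>All constants are compared by writing their powers as exponentials of \<open>ln q\<close>, \<open>ln (1 - q)\<close> and \<open>ln (1 + q)\<close>;
what remains are infinite products, which cancel.\<close>

lemma q_Gamma_eq: "q_Gamma (q\<^sup>2) y = qpoch_inf p p / qpoch_inf (q powr (2 * y)) p * exp ((1 - y) * (ln_1mq + ln_1pq))"
  unfolding q_Gamma_def one_minus_p_powr using pow_p by (simp add: p_def)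

lemma q_Gamma_alpha_1:
  "q_Gamma (q\<^sup>2) (\<alpha> + 1) = qpoch_inf p p / qpoch_inf w p * exp (- \<alpha> * (ln_1mq + ln_1pq))"
  unfolding q_Gamma_eq w_def by (simp add: algebra_simps)

lemma q_Gamma_half:
  "q_Gamma (q\<^sup>2) (1 / 2) = qpoch_inf p p / qpoch_inf q p * exp (1 / 2 * (ln_1mq + ln_1pq))"
  unfolding q_Gamma_eq using q_pos by simp

lemma q_Gamma_alpha_half:
  "q_Gamma (q\<^sup>2) (\<alpha> + 1 / 2) = qpoch_inf p p / qpoch_inf b p * exp ((1 / 2 - \<alpha>) * (ln_1mq + ln_1pq))"
  unfolding q_Gamma_eq b_def by (simp add: algebra_simps)

lemma qpoch_infs_pos: "0 < qpoch_inf p p" "0 < qpoch_inf b p" "0 < qpoch_inf w p" "0 < qpoch_inf q p"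
  using qpoch_inf_pos p_bounds b_bounds w_bounds q_less by auto

lemma q_as_exp: "q = exp ln_q" "1 - q = exp ln_1mq" "1 + q = exp ln_1pq"
  using q_pos q_less by simp_all

text \<open>The shift by \<open>s\<close> becomes a power of \<open>1 - q\<close>.\<close>

lemma powi_s: "(q powr y) powi (1 - s) = exp (y * (ln_q - ln_1mq))"
proof -
  have "(q powr y) powi s = (1 - q) powr y"
    using q_pos by (simp add: q_s powi_powr)
  then have "(q powr y) powi (1 - s) = q powr y / (1 - q) powr y"
    using q_pos by (simp add: power_int_diff)
  also have "\<dots> = exp (y * (ln_q - ln_1mq))"
    using q_pos q_less by (simp add: powr_def exp_diff algebra_simps)
  finally show ?thesis .
qed

lemma rl_const_eq: "rl_const = qpoch_inf q p / qpoch_inf w p"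
proof -
  have "exp ln_1pq * exp (- \<alpha> * (ln_1mq + ln_1pq)) * exp ln_1mq
      = exp (1 / 2 * (ln_1mq + ln_1pq)) * exp ((1 / 2 - \<alpha>) * (ln_1mq + ln_1pq))"
    unfolding exp_add[symmetric] by (rule arg_cong[of _ _ exp]) (simp add: algebra_simps)
  then have "(1 + q) * exp (- \<alpha> * (ln_1mq + ln_1pq)) * (1 - q)
      = exp (1 / 2 * (ln_1mq + ln_1pq)) * exp ((1 / 2 - \<alpha>) * (ln_1mq + ln_1pq))"
    using q_as_exp by simp
  moreover have "g * (qpoch_inf p p / qpoch_inf w p * e) / (qpoch_inf p p / qpoch_inf q p * e' * (qpoch_inf p p / qpoch_inf b p * e'')) * r * (qpoch_inf p p / qpoch_inf b p) = qpoch_inf q p / qpoch_inf w p"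
    if "g * e * r = e' * e''" "e' > 0" "e'' > 0" for g r e e' e''
    using that qpoch_infs_pos by (simp add: field_simps)
  ultimately show ?thesis
    unfolding rl_const_def q_Gamma_alpha_1 q_Gamma_half q_Gamma_alpha_half by (metis exp_gt_zero)
qed

lemma weyl_factor_eq: "weyl_factor * kernel_ratio = exp ((1 / 2 + \<alpha>) * (ln_q + ln_1mq))"
proof -
  have "exp ln_q * exp ((- \<alpha> + 1 / 2) * (ln_1pq - ln_q)) * exp ln_1mq
      = exp ((1 / 2 + \<alpha>) * (ln_q + ln_1mq)) * exp ((1 / 2 - \<alpha>) * (ln_1mq + ln_1pq))"
    unfolding exp_add[symmetric] by (rule arg_cong[of _ _ exp]) (simp add: algebra_simps)
  then have "q * exp ((- \<alpha> + 1 / 2) * (ln_1pq - ln_q)) * (1 - q)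
      = exp ((1 / 2 + \<alpha>) * (ln_q + ln_1mq)) * exp ((1 / 2 - \<alpha>) * (ln_1mq + ln_1pq))"
    using q_as_exp by simp
  moreover have "g * u / (qpoch_inf p p / qpoch_inf b p * e) * r * (qpoch_inf p p / qpoch_inf b p) = t"
    if "g * u * r = t * e" "e > 0" for g u r e t
    using that qpoch_infs_pos by (simp add: field_simps)
  ultimately show ?thesis
    unfolding weyl_factor_def q_Gamma_alpha_half one_plus_inverse_q_powr by (metis exp_gt_zero)
qed

lemma q_c_alpha_eq: "q_c q \<alpha> * (1 - q) = qpoch_inf w p / qpoch_inf p p * exp (\<alpha> * (ln_q + ln_1mq) + ln_1mq)"
proof -
  have "exp (- \<alpha> * (ln_1pq - ln_q)) * exp ln_1mq
      = exp (\<alpha> * (ln_q + ln_1mq) + ln_1mq) * exp (- \<alpha> * (ln_1mq + ln_1pq))"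
    unfolding exp_add[symmetric] by (rule arg_cong[of _ _ exp]) (simp add: algebra_simps)
  then have "exp (- \<alpha> * (ln_1pq - ln_q)) * (1 - q)
      = exp (\<alpha> * (ln_q + ln_1mq) + ln_1mq) * exp (- \<alpha> * (ln_1mq + ln_1pq))"
    using q_as_exp by simp
  moreover have "u / (qpoch_inf p p / qpoch_inf w p * e) * r = qpoch_inf w p / qpoch_inf p p * t" if "u * r = t * e" "e > 0" for u r e t
    using that qpoch_infs_pos by (simp add: field_simps)
  ultimately show ?thesis
    unfolding q_c_def q_Gamma_alpha_1 one_plus_inverse_q_powr by (metis exp_gt_zero)
qed

lemma q_c_half_eq: "q_c q (- 1 / 2) * (1 - q) = qpoch_inf q p / qpoch_inf p p * exp (1 / 2 * (ln_1mq - ln_q))"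
proof -
  have "exp (- (- 1 / 2) * (ln_1pq - ln_q)) * exp ln_1mq
      = exp (1 / 2 * (ln_1mq - ln_q)) * exp (1 / 2 * (ln_1mq + ln_1pq))"
    unfolding exp_add[symmetric] by (rule arg_cong[of _ _ exp]) (simp add: algebra_simps)
  then have "exp (- (- 1 / 2) * (ln_1pq - ln_q)) * (1 - q)
      = exp (1 / 2 * (ln_1mq - ln_q)) * exp (1 / 2 * (ln_1mq + ln_1pq))"
    using q_as_exp by simp
  moreover have "u / (qpoch_inf p p / qpoch_inf q p * e) * r = qpoch_inf q p / qpoch_inf p p * t" if "u * r = t * e" "e > 0" for u r e t
    using that qpoch_infs_pos by (simp add: field_simps)
  moreover have "- 1 / 2 + 1 = (1 / 2 :: real)" by simp
  ultimately show ?thesis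
    unfolding q_c_def q_Gamma_half one_plus_inverse_q_powr by (metis exp_gt_zero q_Gamma_half)
qed

lemma q_kappa_eq: "q_kappa q \<alpha> = qpoch_inf w p / qpoch_inf q p * exp ((\<alpha> + 1 / 2) * ln_1mq - (3 * \<alpha> + 3 / 2) * ln_q)"
proof -
  have "exp (1 / 2 * (ln_1mq + ln_1pq))
      = exp ((\<alpha> + 1 / 2) * ln_1mq - (3 * \<alpha> + 3 / 2) * ln_q) *
        (exp ((3 * \<alpha> + 3 / 2) * ln_q) * exp ((\<alpha> + 1 / 2) * ln_1pq) * exp (- \<alpha> * (ln_1mq + ln_1pq)))"
    unfolding exp_add[symmetric] by (rule arg_cong[of _ _ exp]) (simp add: algebra_simps)
  moreover have "qpoch_inf p p / qpoch_inf q p * e / (u * v * (qpoch_inf p p / qpoch_inf w p * e')) = qpoch_inf w p / qpoch_inf q p * t"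
    if "e = t * (u * v * e')" "u > 0" "v > 0" "e' > 0" for u v e e' t
    using that qpoch_infs_pos by (simp add: field_simps)
  moreover have "q powr (3 * \<alpha> + 3 / 2) = exp ((3 * \<alpha> + 3 / 2) * ln_q)"
    and "(1 + q) powr (\<alpha> + 1 / 2) = exp ((\<alpha> + 1 / 2) * ln_1pq)"
    using q_pos by (simp_all add: powr_def)
  ultimately show ?thesis
    unfolding q_kappa_def q_Gamma_alpha_1 q_Gamma_half by (metis exp_gt_zero)
qed

lemma hankel_const_eq: "hankel_const = exp ((2 * \<alpha> + 2) * (ln_q - ln_1mq)) * (qpoch_inf p p / qpoch_inf w p)\<^sup>2"
  unfolding hankel_const_def w_def powi_s ..

lemma weyl_const_eq: "weyl_const = exp ((2 * \<alpha> + 1) * (ln_q - ln_1mq)) * qpoch_inf q p / qpoch_inf w p"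
  unfolding weyl_const_def b_def powi_s ..

text \<open>One factor \<open>(w;p)\<^sub>\<infinity> / (q;p)\<^sub>\<infinity>\<close> comes from the cosine transform of \<open>W f\<close>, the other from \<open>R\<close>.\<close>

lemma constants_K1:
  "rl_const * q_kappa q \<alpha> * (q_c q (- 1 / 2) * (1 - q))\<^sup>2 * (weyl_factor * kernel_ratio)
     * (qpoch_inf w p / qpoch_inf q p)\<^sup>2 * hankel_const = 1"
proof -
  have "exp ((\<alpha> + 1 / 2) * ln_1mq - (3 * \<alpha> + 3 / 2) * ln_q) *
      (exp (1 / 2 * (ln_1mq - ln_q)) * exp (1 / 2 * (ln_1mq - ln_q))) *
      exp ((1 / 2 + \<alpha>) * (ln_q + ln_1mq)) * exp ((2 * \<alpha> + 2) * (ln_q - ln_1mq)) = 1"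
    unfolding exp_add[symmetric] exp_eq_one_iff by (simp add: algebra_simps)
  moreover have "qpoch_inf q p / qpoch_inf w p * (qpoch_inf w p / qpoch_inf q p * k) * (qpoch_inf q p / qpoch_inf p p * c)\<^sup>2 * v * (qpoch_inf w p / qpoch_inf q p)\<^sup>2 * (h * (qpoch_inf p p / qpoch_inf w p)\<^sup>2) = k * (c * c) * v * h"
    for k c v h
    using qpoch_infs_pos by (simp add: field_simps power2_eq_square)
  ultimately show ?thesis
    unfolding rl_const_eq q_kappa_eq q_c_half_eq weyl_factor_eq hankel_const_eq by metis
qed

lemma constants_K2:
  "rl_const * (weyl_factor * kernel_ratio) * (q_kappa q \<alpha> * q powr (- 4 * \<alpha> - 2) * (q_c q \<alpha> * (1 - q))\<^sup>2)
     * weyl_const * (qpoch_inf w p / qpoch_inf q p) * hankel_const = 1"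
proof -
  have "exp ((1 / 2 + \<alpha>) * (ln_q + ln_1mq)) * (exp ((\<alpha> + 1 / 2) * ln_1mq - (3 * \<alpha> + 3 / 2) * ln_q) *
      exp ((- 4 * \<alpha> - 2) * ln_q) * (exp (\<alpha> * (ln_q + ln_1mq) + ln_1mq) * exp (\<alpha> * (ln_q + ln_1mq) + ln_1mq))) *
      exp ((2 * \<alpha> + 1) * (ln_q - ln_1mq)) * exp ((2 * \<alpha> + 2) * (ln_q - ln_1mq)) = 1"
    unfolding exp_add[symmetric] exp_eq_one_iff by (simp add: algebra_simps)
  moreover have "q powr (- 4 * \<alpha> - 2) = exp ((- 4 * \<alpha> - 2) * ln_q)"
    using q_pos by (simp add: powr_def)
  moreover have "qpoch_inf q p / qpoch_inf w p * v * (qpoch_inf w p / qpoch_inf q p * k * n * (qpoch_inf w p / qpoch_inf p p * c)\<^sup>2) * (l * qpoch_inf q p / qpoch_inf w p) * (qpoch_inf w p / qpoch_inf q p) * (h * (qpoch_inf p p / qpoch_inf w p)\<^sup>2)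
      = v * (k * n * (c * c)) * l * h"
    for k c v h n l
    using qpoch_infs_pos by (simp add: field_simps power2_eq_square)
  ultimately show ?thesis
    unfolding rl_const_eq q_kappa_eq q_c_alpha_eq weyl_factor_eq hankel_const_eq weyl_const_eq by metis
qed

section \<open>Schwartz functions on the lattice\<close>

lemma q_schwartz_even:
  assumes "f \<in> q_schwartz q" and "x \<in> q_lattice q"
  shows "f (- x) = f x"
proof -
  have "- x \<in> q_lattice q"
    using assms(2) unfolding q_lattice_def by auto
  then show ?thesis using assms unfolding q_schwartz_def by auto
qed

lemma q_seminorm_bound:
  assumes "q_seminorm q 0 m F < \<infinity>"
  obtains B where "\<And>x. (1 + x\<^sup>2) ^ m * cmod (F x) \<le> B"
proof
  fix x
  have "ennreal (cmod ((1 + x\<^sup>2) ^ m *\<^sub>R F x)) \<le> q_seminorm q 0 m F"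
    unfolding q_seminorm_def by (rule SUP_upper2[of "(x, 0)"]) auto
  also have "\<dots> = ennreal (enn2real (q_seminorm q 0 m F))"
    using assms by simp
  finally have "cmod ((1 + x\<^sup>2) ^ m *\<^sub>R F x) \<le> enn2real (q_seminorm q 0 m F)"
    by (simp add: ennreal_le_iff)
  then show "(1 + x\<^sup>2) ^ m * cmod (F x) \<le> enn2real (q_seminorm q 0 m F)"
    by simp
qed

text \<open>Boundedness and differentiability at 0 give the Lipschitz bound, polynomial decay gives summability at
infinity.\<close>

lemma q_schwartz_lattice_bounds:
  assumes "f \<in> q_schwartz q"
  shows "weighted_summable (\<lambda>k. f (q powi k))"
    and "\<exists>C. \<forall>k. cmod (f (q powi k) - f 0) \<le> C * q powi k"
proof -
  obtain F where F: "infinitely_q_differentiable q F" "\<And>n m. q_seminorm q n m F < \<infinity>"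
    "\<And>x. x \<in> q_lattice q \<Longrightarrow> f x = F x"
    using assms unfolding q_schwartz_def by auto
  have f_powi: "f (q powi k) = F (q powi k)" for k using F(3) by (auto simp: q_lattice_def)
  have f_0: "f 0 = F 0" using F(3) by (auto simp: q_lattice_def)
  obtain B where "\<And>x. (1 + x\<^sup>2) ^ 0 * cmod (F x) \<le> B"
    using q_seminorm_bound[OF F(2)[of 0 0]] by blast
  then have B: "\<And>x. cmod (F x) \<le> B" by simp
  \<comment> \<open>\<open>2 M\<close> has to exceed the exponent \<open>2 \<alpha> + 2\<close> of the weight.\<close>
  define M where "M = nat \<lceil>\<alpha> + 2\<rceil>"
  obtain B' where B': "\<And>x. (1 + x\<^sup>2) ^ M * cmod (F x) \<le> B'"
    using q_seminorm_bound[OF F(2)[of 0 M]] by blast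
  define z where "z = w / q ^ (2 * M)"
  have z: "1 < z"
  proof -
    have "\<alpha> + 1 < real M" unfolding M_def by linarith
    then have "q powr real (2 * M) < w"
      unfolding w_def using q_pos q_less by (intro powr_less_mono') auto
    then have "q ^ (2 * M) < w" using q_pos by (simp only: powr_realpow)
    then show ?thesis unfolding z_def using q_pos by simp
  qed
  have "(\<lambda>k. norm (w powi k *\<^sub>R f (q powi k))) summable_on UNIV"
  proof (rule summable_on_int_two_sided[OF w_bounds z])
    fix k
    show "norm (w powi k *\<^sub>R f (q powi k)) \<le> B * w powi k"
      using w_bounds B[of "q powi k"] by (simp add: f_powi mult.commute mult_left_mono)
    let ?x = "q powi k"
    have "(?x\<^sup>2) ^ M * cmod (F ?x) \<le> (1 + ?x\<^sup>2) ^ M * cmod (F ?x)"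
      by (intro mult_right_mono power_mono) auto
    also have "\<dots> \<le> B'" by (rule B')
    finally have "cmod (F ?x) \<le> B' / (q ^ (2 * M)) powi k"
    proof -
      assume *: "(?x\<^sup>2) ^ M * cmod (F ?x) \<le> B'"
      have "(?x\<^sup>2) ^ M = (q ^ (2 * M)) powi k"
        by (metis power_int_mult power_int_of_nat power_mult mult.commute)
      then show ?thesis using * q_pos by (simp add: field_simps)
    qed
    then have "w powi k * cmod (F ?x) \<le> w powi k * (B' / (q ^ (2 * M)) powi k)"
      using w_bounds by (intro mult_left_mono) auto
    also have "\<dots> = B' * z powi k"
      by (simp add: z_def power_int_divide_distrib)
    finally show "norm (w powi k *\<^sub>R f (q powi k)) \<le> B' * z powi k"
      using w_bounds by (simp add: f_powi)
  qed
  then show "weighted_summable (\<lambda>k. f (q powi k))"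
    unfolding weighted_summable_def using w_bounds by simp
  have "((q_deriv q ^^ 0) F) differentiable (at 0)"
    using F(1) unfolding infinitely_q_differentiable_def by blast
  then obtain D where D: "(F has_vector_derivative D) (at 0)"
    by (auto simp: vector_derivative_works)
  have "((\<lambda>x. (F x - F 0 - x *\<^sub>R D) /\<^sub>R \<bar>x\<bar>) \<longlongrightarrow> 0) (at 0)"
    using D unfolding has_vector_derivative_def has_derivative_def by simp
  then have "eventually (\<lambda>x. norm ((F x - F 0 - x *\<^sub>R D) /\<^sub>R \<bar>x\<bar>) < 1) (at 0)"
    by (intro order_tendstoD(2)[OF tendsto_norm_zero]) auto
  then obtain d where d: "d > 0"
    "\<And>x. x \<noteq> 0 \<Longrightarrow> \<bar>x\<bar> < d \<Longrightarrow> norm ((F x - F 0 - x *\<^sub>R D) /\<^sub>R \<bar>x\<bar>) < 1"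
    by (auto simp: eventually_at dist_norm)
  \<comment> \<open>Close to 0 the derivative bounds the difference quotient; farther away \<open>2 B\<close> does, because \<open>x \<ge> d\<close>.\<close>
  define C where "C = max (1 + norm D) (2 * B / d)"
  have "cmod (F x - F 0) \<le> C * x" if "x > 0" for x
  proof (cases "x < d")
    case True
    have "norm (F x - F 0 - x *\<^sub>R D) < x" using d(2)[of x] that True unfolding norm_scaleR by (simp add: field_simps)
    moreover have "norm (F x - F 0) \<le> norm (F x - F 0 - x *\<^sub>R D) + norm (x *\<^sub>R D)"
      using norm_triangle_ineq[of "F x - F 0 - x *\<^sub>R D" "x *\<^sub>R D"] by simp
    ultimately have "norm (F x - F 0) \<le> x + x * norm D" using that by simp
    also have "\<dots> = (1 + norm D) * x" by (simp add: algebra_simps)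
    also have "\<dots> \<le> C * x" using that by (intro mult_right_mono) (auto simp: C_def)
    finally show ?thesis .
  next
    case False
    have "norm (F x - F 0) \<le> B + B"
      using norm_triangle_ineq4[of "F x" "F 0"] B[of x] B[of 0] by linarith
    also have "\<dots> = 2 * B / d * d" using d(1) by simp
    also have "\<dots> \<le> C * x"
    proof (rule mult_mono)
      show "2 * B / d \<le> C" by (simp add: C_def)
      show "d \<le> x" using False by simp
      show "0 \<le> C" unfolding C_def using norm_ge_zero[of D] by linarith
    qed (use d in simp)
    finally show ?thesis .
  qed
  then have "\<forall>k. cmod (f (q powi k) - f 0) \<le> C * q powi k"
    unfolding f_powi f_0 using q_pos by simp
  then show "\<exists>C. \<forall>k. cmod (f (q powi k) - f 0) \<le> C * q powi k" by blast
qed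

section \<open>The inversion formulas\<close>

context
  fixes f :: "real \<Rightarrow> complex"
  assumes f: "f \<in> q_schwartz q"
begin

text \<open>The \<open>q\<close>-Bessel Fourier transform of \<open>f\<close> on the lattice, without its constant factor.\<close>

definition spectrum :: "int \<Rightarrow> complex" where
  "spectrum = (\<lambda>k. hankel w (\<lambda>k. f (q powi k)) (q powi k))"

lemma spectrum_apply: "spectrum k = hankel w (\<lambda>k. f (q powi k)) (q powi k)"
  by (simp add: spectrum_def)

lemma spectrum_weighted_summable: "weighted_summable spectrum"
proof -
  obtain C where "\<And>k. cmod (f (q powi k) - f 0) \<le> C * q powi k"
    using q_schwartz_lattice_bounds(2)[OF f] by blast
  then show ?thesis
    unfolding spectrum_def by (rule hankel_weighted_summable[OF q_schwartz_lattice_bounds(1)[OF f]])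
qed

lemma hankel_spectrum:
  assumes "x \<in> nonneg_lattice"
  shows "hankel w spectrum x = hankel_const *\<^sub>R f x"
proof (cases "x = 0")
  case True
  obtain C where C: "\<And>k. cmod (f (q powi k) - f 0) \<le> C * q powi k"
    using q_schwartz_lattice_bounds(2)[OF f] by blast
  have "(\<lambda>n. C * q ^ n) \<longlonglongrightarrow> C * 0"
    using q_pos q_less by (intro tendsto_intros LIMSEQ_power_zero) auto
  then have lim: "(\<lambda>n. C * q ^ n) \<longlonglongrightarrow> 0" by simp
  have "cmod (f (q powi int n) - f 0) \<le> C * q ^ n" for n
    using C[of "int n"] by simp
  then have "eventually (\<lambda>n. cmod (f (q powi int n) - f 0) \<le> C * q ^ n) sequentially"
    by (simp add: always_eventually)
  then have "(\<lambda>n. f (q powi int n) - f 0) \<longlonglongrightarrow> 0"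
    using lim by (rule Lim_null_comparison)
  then have "(\<lambda>n. f (q powi int n)) \<longlonglongrightarrow> f 0"
    by (rule LIM_zero_cancel)
  then show ?thesis
    using hankel_hankel_0[OF q_schwartz_lattice_bounds(1)[OF f] spectrum_weighted_summable[unfolded spectrum_def]]
    unfolding spectrum_def True by simp
next
  case False
  then obtain n where "x = q powi n" using assms by (auto simp: nonneg_lattice_def)
  then show ?thesis
    using hankel_hankel[OF q_schwartz_lattice_bounds(1)[OF f], of n] unfolding spectrum_def by simp
qed

lemma inversion_K1:
  assumes x: "x \<in> nonneg_lattice"
  shows "q_riemann_liouville q \<alpha> (q_K1 q \<alpha> (q_weyl q \<alpha> f)) x = f x"
proof -
  let ?r = "qpoch_inf w p / qpoch_inf q p" and ?c = "q_c q (- 1 / 2) * (1 - q)"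
    and ?k = "q_kappa q \<alpha>" and ?v = "weyl_factor * kernel_ratio"
  have 1: "q_fourier_cos q (q_weyl q \<alpha> f) (q powi l) = (?c * ?v * ?r) *\<^sub>R spectrum l" for l
    unfolding q_fourier_cos_eq_hankel q_weyl_lattice hankel_scaleR spectrum_apply
      hankel_q_weyl_sum[OF q_schwartz_lattice_bounds(1)[OF f]] by simp
  have 2: "q_K1 q \<alpha> (q_weyl q \<alpha> f) y = (?k * ?c * (?c * ?v * ?r)) *\<^sub>R cos_transform spectrum y" for y
  proof -
    have e: "\<bar>q powi k\<bar> powr (2 * \<alpha> + 1) *\<^sub>R q_fourier_cos q (q_weyl q \<alpha> f) (q powi k)
        = (?c * ?v * ?r) *\<^sub>R b powi k *\<^sub>R spectrum k" for k
      unfolding 1 using q_pos powi_powr_b[of k] by simp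
    show ?thesis
      unfolding q_K1_def q_fourier_cos_inv_def
        q_fourier_cos_eq_hankel[of "\<lambda>l. \<bar>l\<bar> powr (2 * \<alpha> + 1) *\<^sub>R q_fourier_cos q (q_weyl q \<alpha> f) l"]
        e hankel_scaleR hankel_q_weight
      by (simp only: scaleR_scaleR mult.assoc)
  qed
  have "q_riemann_liouville q \<alpha> (q_K1 q \<alpha> (q_weyl q \<alpha> f)) x
      = rl_const *\<^sub>R (\<Sum>\<^sub>\<infinity>j. (?k * ?c * (?c * ?v * ?r)) *\<^sub>R (beta_coeff j * q ^ j) *\<^sub>R cos_transform spectrum (x * q ^ j))"
    unfolding q_riemann_liouville_eq_sum 2 by (simp only: scaleR_scaleR mult_ac)
  also have "\<dots> = (rl_const * (?k * ?c * (?c * ?v * ?r)) * ?r * hankel_const) *\<^sub>R f x"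
    unfolding infsum_scaleR_right riemann_liouville_cos_transform[OF spectrum_weighted_summable x] hankel_spectrum[OF x]
    by (simp only: scaleR_scaleR mult.assoc)
  also have "rl_const * (?k * ?c * (?c * ?v * ?r)) * ?r * hankel_const = 1"
    using constants_K1 by (simp only: power2_eq_square mult_ac)
  finally show ?thesis by simp
qed

lemma inversion_K2:
  assumes x: "x \<in> nonneg_lattice"
  shows "q_riemann_liouville q \<alpha> (q_weyl q \<alpha> (q_K2 q \<alpha> f)) x = f x"
proof -
  let ?r = "qpoch_inf w p / qpoch_inf q p" and ?c = "q_c q \<alpha> * (1 - q)"
    and ?k = "q_kappa q \<alpha> * q powr (- 4 * \<alpha> - 2)" and ?v = "weyl_factor * kernel_ratio"
  let ?d = "?k * ?c * ?c"
  have K2: "q_K2 q \<alpha> f y = ?d *\<^sub>R hankel w (\<lambda>k. b powi k *\<^sub>R spectrum k) y" for y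
  proof -
    have e: "\<bar>q powi k\<bar> powr (2 * \<alpha> + 1) *\<^sub>R ?c *\<^sub>R spectrum k = ?c *\<^sub>R b powi k *\<^sub>R spectrum k" for k
      using q_pos powi_powr_b[of k] by simp
    show ?thesis
      unfolding q_K2_def q_bessel_fourier_inv_def q_bessel_fourier_eq_hankel spectrum_apply[symmetric] e hankel_scaleR
      by (simp only: scaleR_scaleR mult.assoc)
  qed
  have W: "q_weyl q \<alpha> (q_K2 q \<alpha> f) y = (?v * ?d * weyl_const) *\<^sub>R cos_transform spectrum y"
    if y: "y \<in> nonneg_lattice" for y
  proof (cases "y = 0")
    case True
    have "(\<Sum>\<^sub>\<infinity>m. b powi m *\<^sub>R ?d *\<^sub>R hankel w (\<lambda>k. b powi k *\<^sub>R spectrum k) (q powi m))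
       = (\<Sum>\<^sub>\<infinity>m. ?d *\<^sub>R b powi m *\<^sub>R hankel w (\<lambda>k. b powi k *\<^sub>R spectrum k) (q powi m))"
      by (simp only: scaleR_scaleR mult_ac)
    then show ?thesis
      unfolding True q_weyl_0 K2 infsum_scaleR_right weyl_integral_hankel[OF spectrum_weighted_summable]
      by (simp only: infsum_scaleR_right weyl_integral_hankel[OF spectrum_weighted_summable] scaleR_scaleR mult_ac)
  next
    case False
    then obtain n where n: "y = q powi n" using y by (auto simp: nonneg_lattice_def)
    show ?thesis
      unfolding n q_weyl_lattice K2 weyl_sum_scaleR weyl_sum_hankel[OF spectrum_weighted_summable]
      by (simp only: scaleR_scaleR mult.assoc)
  qed
  have "q_riemann_liouville q \<alpha> (q_weyl q \<alpha> (q_K2 q \<alpha> f)) x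
      = rl_const *\<^sub>R (\<Sum>\<^sub>\<infinity>j. (?v * ?d * weyl_const) *\<^sub>R (beta_coeff j * q ^ j) *\<^sub>R cos_transform spectrum (x * q ^ j))"
    unfolding q_riemann_liouville_eq_sum W[OF nonneg_lattice_mult_power[OF x]] by (simp only: scaleR_scaleR mult_ac)
  also have "\<dots> = (rl_const * (?v * ?d * weyl_const) * ?r * hankel_const) *\<^sub>R f x"
    unfolding infsum_scaleR_right riemann_liouville_cos_transform[OF spectrum_weighted_summable x] hankel_spectrum[OF x]
    by (simp only: scaleR_scaleR mult.assoc)
  also have "rl_const * (?v * ?d * weyl_const) * ?r * hankel_const = 1"
    using constants_K2 by (simp only: power2_eq_square mult_ac)
  finally show ?thesis by simp
qed

end

end

theorem theorem11:
  fixes q \<alpha> :: real and f :: "real \<Rightarrow> complex"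
  assumes "0 < q" and "q < 1" and "ln (1 - q) / ln q \<in> \<int>" and "\<alpha> > - 1 / 2"
    and "f \<in> q_schwartz_moments q \<alpha>"
  shows "(\<forall>x\<in>q_lattice q. f x = (q_riemann_liouville q \<alpha> \<circ> q_K1 q \<alpha> \<circ> q_weyl q \<alpha>) f x) \<and>
         (\<forall>x\<in>q_lattice q. f x = (q_riemann_liouville q \<alpha> \<circ> q_weyl q \<alpha> \<circ> q_K2 q \<alpha>) f x)"
proof -
  obtain s :: int where "ln (1 - q) / ln q = of_int s"
    using assms(3) by (rule Ints_cases)
  then have "ln (1 - q) = of_int s * ln q"
    using assms(1,2) by (simp add: field_simps)
  then have "1 - q = q powr of_int s"
    using assms(1,2) by (simp add: powr_def) (metis diff_gt_0_iff_gt exp_ln)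
  then have "1 - q = q powi s"
    using assms(1) by (simp add: powr_real_of_int')
  then interpret q_bessel_lattice q \<alpha> s
    using assms by unfold_locales auto
  have f: "f \<in> q_schwartz q" using assms(5) by (simp add: q_schwartz_moments_def)
  \<comment> \<open>Half of the lattice suffices because both sides are even in \<open>x\<close>.\<close>
  have cases: "x \<in> nonneg_lattice \<or> - x \<in> nonneg_lattice" if "x \<in> q_lattice q" for x
    using that unfolding q_lattice_def nonneg_lattice_def by auto
  have 1: "f x = q_riemann_liouville q \<alpha> (q_K1 q \<alpha> (q_weyl q \<alpha> f)) x" if x: "x \<in> q_lattice q" for x
    using cases[OF x] inversion_K1[OF f, of x] inversion_K1[OF f, of "- x"] q_schwartz_even[OF f x]
      q_riemann_liouville_minus[of "q_K1 q \<alpha> (q_weyl q \<alpha> f)" x, OF q_K1_minus] by auto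
  have 2: "f x = q_riemann_liouville q \<alpha> (q_weyl q \<alpha> (q_K2 q \<alpha> f)) x" if x: "x \<in> q_lattice q" for x
    using cases[OF x] inversion_K2[OF f, of x] inversion_K2[OF f, of "- x"] q_schwartz_even[OF f x]
      q_riemann_liouville_minus[of "q_weyl q \<alpha> (q_K2 q \<alpha> f)" x, OF q_weyl_minus] by auto
  show ?thesis using 1 2 by simp
qed

end
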